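(* Let $(W,S)$ be a Coxeter system with $S$ finite, and let $\Sigma=\Sigma(W,S)$ be its Davis complex. Then: (a) Every element of $\operatorname{Aut}(\Sigma)$ is the composition of a left-multiplication automorphism and a diagram automorphism of $\Sigma$ if and only if the defining diagram of $(W,S)$ is not flexible. (b) $\operatorname{Aut}(\Sigma)$ is a discrete group if and only if the defining diagram of $(W,S)$ is not flexible. (c) The defining diagram of $(W,S)$ is not flexible if and only if $\operatorname{Aut}(\Sigma)$ can be written as a semidirect product $\operatorname{Aut}(\Sigma)=W\rtimes D$, where $W$ and $D$ are the subgroups of left-multiplication automorphisms and of diagram automorphisms of $\Sigma$, respectively (internal semidirect product, with the subgroup of left-multiplication automorphisms normal).
   Context: A Coxeter system $(W,S)$ is a group $W$ with generating set $S$ and presentation $\langle S \mid s^2\ (s\in S),\ (st)^{m_{st}}\ (s\neq t\in S,\ m_{st}<\infty)\rangle$, where $m_{st}=m_{ts}\in\{2,3,\dots\}\cup\{\infty\}$ is the order of $st$ for $s \ne t$. The defining diagram of $(W,S)$ is the labelled graph with vertex set $S$, with an edge between distinct $s,t$ if and only if $m_{st}<\infty$, this edge being labelled $m_{st}$. It is flexible if there are a vertex $s\in S$ and a nontrivial label-preserving automorphism $\phi$ of the defining diagram such that $\phi$ fixes $s$ and fixes every vertex joined to $s$ by an edge of the defining diagram. For $T\subseteq S$ let $W_T=\langle T\rangle$; $T$ is spherical if $W_T$ is finite. The Davis complex $\Sigma$ is the cell complex whose cells are indexed by the poset, ordered by inclusion, of cosets $wW_T$ ($w\in W$, $T\subseteq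 S$ spherical); equivalently $\Sigma$ is the geometric realisation of this poset. The chamber of $w\in W$ is the union of the simplices of the realisation corresponding to chains of cosets containing $w$, and the chambers of $w$ and $ws$ are adjacent (along the mirror of type $s$). $\operatorname{Aut}(\Sigma)$ is the group of automorphisms of this cell structure, i.e. of the poset; such automorphisms take chambers to chambers and preserve adjacency of chambers. It carries the topology in which the pointwise stabilisers of finite sets of cells form a neighbourhood basis of the identity. The left-multiplication automorphisms of $\Sigma$ are those induced by $x\mapsto wx$ ($w\in W$), and the diagram automorphisms of $\Sigma$ are those induced by group automorphisms of $W$ extending a permutation $\pi$ of $S$ with $m_{\pi(s)\pi(t)}=m_{st}$ for all distinct $s,t\in S$. *)

theory Defs
  imports
    "HOL-Analysis.Abstract_Topology"
    "HOL-Library.Extended_Nat"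
    "HOL-Algebra.Generated_Groups"
    "HOL-Algebra.Multiplicative_Group"
    "HOL-Algebra.Bij"
begin

section \<open>Group presentations\<close>

text \<open>
  A word in the elements of \<open>S\<close> and their formal inverses is a list of signed
  letters: \<open>(s, True)\<close> stands for \<open>s\<close> and \<open>(s, False)\<close> for its formal inverse.
\<close>

type_synonym 'a word = "('a \<times> bool) list"

definition words_over :: "'a set \<Rightarrow> 'a word set" where
  "words_over S = lists (S \<times> UNIV)"

definition eval_word :: "('a, 'b) monoid_scheme \<Rightarrow> 'a word \<Rightarrow> 'a" where
  "eval_word G u =
     foldr (\<lambda>(s, b) g. (if b then s else inv\<^bsub>G\<^esub> s) \<otimes>\<^bsub>G\<^esub> g) u \<one>\<^bsub>G\<^esub>"

text \<open>
  Two words are related iff they define the same element of the quotient of the free group on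
  \<open>S\<close> by the normal closure of \<open>R\<close>.
\<close>

inductive pres_equiv :: "'a set \<Rightarrow> 'a word set \<Rightarrow> 'a word \<Rightarrow> 'a word \<Rightarrow> bool"
  for S :: "'a set" and R :: "'a word set"
where
  refl: "u \<in> words_over S \<Longrightarrow> pres_equiv S R u u"
| sym: "pres_equiv S R u v \<Longrightarrow> pres_equiv S R v u"
| trans: "pres_equiv S R u v \<Longrightarrow> pres_equiv S R v w \<Longrightarrow> pres_equiv S R u w"
| cancel: "u \<in> words_over S \<Longrightarrow> v \<in> words_over S \<Longrightarrow> s \<in> S \<Longrightarrow>
    pres_equiv S R (u @ [(s, b), (s, \<not> b)] @ v) (u @ v)"
| relator: "u \<in> words_over S \<Longrightarrow> v \<in> words_over S \<Longrightarrow> r \<in> R \<Longrightarrow>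
    pres_equiv S R (u @ r @ v) (u @ v)"

definition has_presentation ::
  "('a, 'b) monoid_scheme \<Rightarrow> 'a set \<Rightarrow> 'a word set \<Rightarrow> bool" where
  "has_presentation G S R \<longleftrightarrow>
     group G \<and> S \<subseteq> carrier G \<and> generate G S = carrier G \<and> R \<subseteq> words_over S \<and>
     (\<forall>u\<in>words_over S. \<forall>v\<in>words_over S.
        eval_word G u = eval_word G v \<longleftrightarrow> pres_equiv S R u v)"


section \<open>Coxeter systems and their defining diagrams\<close>

text \<open>In the library, \<^const>\<open>group.ord\<close> is \<open>0\<close> exactly for elements of infinite order.\<close>

definition cox_order :: "('a, 'b) monoid_scheme \<Rightarrow> 'a \<Rightarrow> 'a \<Rightarrow> enat" where
  "cox_order W s t =
     (if group.ord W (s \<otimes>\<^bsub>W\<^esub> t) = 0 then \<infinity> else enat (group.ord W (s \<otimes>\<^bsub>W\<^esub> t)))"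

definition cox_relators :: "('a, 'b) monoid_scheme \<Rightarrow> 'a set \<Rightarrow> 'a word set" where
  "cox_relators W S =
     {[(s, True), (s, True)] | s. s \<in> S} \<union>
     {concat (replicate k [(s, True), (t, True)]) | s t k.
        s \<in> S \<and> t \<in> S \<and> s \<noteq> t \<and> cox_order W s t = enat k}"

definition coxeter_system :: "('a, 'b) monoid_scheme \<Rightarrow> 'a set \<Rightarrow> bool" where
  "coxeter_system W S \<longleftrightarrow> has_presentation W S (cox_relators W S)"

definition diagram_edge :: "('a, 'b) monoid_scheme \<Rightarrow> 'a set \<Rightarrow> 'a \<Rightarrow> 'a \<Rightarrow> bool" where
  "diagram_edge W S s t \<longleftrightarrow> s \<in> S \<and> t \<in> S \<and> s \<noteq> t \<and> cox_order W s t < \<infinity>"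

definition diagram_automorphism ::
  "('a, 'b) monoid_scheme \<Rightarrow> 'a set \<Rightarrow> ('a \<Rightarrow> 'a) \<Rightarrow> bool" where
  "diagram_automorphism W S \<phi> \<longleftrightarrow>
     bij_betw \<phi> S S \<and>
     (\<forall>s\<in>S. \<forall>t\<in>S. diagram_edge W S (\<phi> s) (\<phi> t) \<longleftrightarrow> diagram_edge W S s t) \<and>
     (\<forall>s t. diagram_edge W S s t \<longrightarrow> cox_order W (\<phi> s) (\<phi> t) = cox_order W s t)"

definition flexible_diagram :: "('a, 'b) monoid_scheme \<Rightarrow> 'a set \<Rightarrow> bool" where
  "flexible_diagram W S \<longleftrightarrow>
     (\<exists>s\<in>S. \<exists>\<phi>. diagram_automorphism W S \<phi> \<and> (\<exists>t\<in>S. \<phi> t \<noteq> t) \<and>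
        \<phi> s = s \<and> (\<forall>t. diagram_edge W S s t \<longrightarrow> \<phi> t = t))"


section \<open>The Davis complex and its automorphism group\<close>

text \<open>
  The Davis complex is represented by its poset of cells, the set of cosets below ordered by
  inclusion; its automorphisms are the order automorphisms of this poset.
\<close>

definition spherical :: "('a, 'b) monoid_scheme \<Rightarrow> 'a set \<Rightarrow> 'a set \<Rightarrow> bool" where
  "spherical W S T \<longleftrightarrow> T \<subseteq> S \<and> finite (generate W T)"

definition davis_cells :: "('a, 'b) monoid_scheme \<Rightarrow> 'a set \<Rightarrow> 'a set set" where
  "davis_cells W S =
     {w <#\<^bsub>W\<^esub> generate W T | w T. w \<in> carrier W \<and> spherical W S T}"

definition davis_Aut :: "('a, 'b) monoid_scheme \<Rightarrow> 'a set \<Rightarrow> ('a set \<Rightarrow> 'a set) monoid" where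
  "davis_Aut W S = (BijGroup (davis_cells W S))
     \<lparr>carrier := {f \<in> Bij (davis_cells W S).
        \<forall>A\<in>davis_cells W S. \<forall>B\<in>davis_cells W S. f A \<subseteq> f B \<longleftrightarrow> A \<subseteq> B}\<rparr>"

definition induced_map ::
  "('a, 'b) monoid_scheme \<Rightarrow> 'a set \<Rightarrow> ('a \<Rightarrow> 'a) \<Rightarrow> 'a set \<Rightarrow> 'a set" where
  "induced_map W S h = (\<lambda>A\<in>davis_cells W S. h ` A)"

definition left_mult_auts ::
  "('a, 'b) monoid_scheme \<Rightarrow> 'a set \<Rightarrow> ('a set \<Rightarrow> 'a set) set" where
  "left_mult_auts W S = {induced_map W S (\<lambda>x. w \<otimes>\<^bsub>W\<^esub> x) | w. w \<in> carrier W}"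

definition diagram_auts ::
  "('a, 'b) monoid_scheme \<Rightarrow> 'a set \<Rightarrow> ('a set \<Rightarrow> 'a set) set" where
  "diagram_auts W S =
     {induced_map W S \<alpha> | \<alpha>. \<alpha> \<in> iso W W \<and>
        (\<exists>\<pi>. bij_betw \<pi> S S \<and>
           (\<forall>s\<in>S. \<forall>t\<in>S. s \<noteq> t \<longrightarrow> cox_order W (\<pi> s) (\<pi> t) = cox_order W s t) \<and>
           (\<forall>s\<in>S. \<alpha> s = \<pi> s))}"

definition pointwise_stabiliser ::
  "('a, 'b) monoid_scheme \<Rightarrow> 'a set \<Rightarrow> 'a set set \<Rightarrow> ('a set \<Rightarrow> 'a set) set" where
  "pointwise_stabiliser W S F = {f \<in> carrier (davis_Aut W S). \<forall>A\<in>F. f A = A}"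

text \<open>
  The group topology for which the pointwise stabilisers of finite sets of cells are a
  neighbourhood basis of the identity: neighbourhoods of \<open>f\<close> are left translates by \<open>f\<close>.
\<close>

definition davis_Aut_topology ::
  "('a, 'b) monoid_scheme \<Rightarrow> 'a set \<Rightarrow> ('a set \<Rightarrow> 'a set) topology" where
  "davis_Aut_topology W S = topology (\<lambda>U. U \<subseteq> carrier (davis_Aut W S) \<and>
     (\<forall>f\<in>U. \<exists>F. finite F \<and> F \<subseteq> davis_cells W S \<and>
        f <#\<^bsub>davis_Aut W S\<^esub> pointwise_stabiliser W S F \<subseteq> U))"

lemma openin_davis_Aut_topology:
  "openin (davis_Aut_topology W S) U \<longleftrightarrow> U \<subseteq> carrier (davis_Aut W S) \<and>
     (\<forall>f\<in>U. \<exists>F. finite F \<and> F \<subseteq> davis_cells W S \<and>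
        f <#\<^bsub>davis_Aut W S\<^esub> pointwise_stabiliser W S F \<subseteq> U)"
proof -
  let ?P = "\<lambda>f F. f <#\<^bsub>davis_Aut W S\<^esub> pointwise_stabiliser W S F"
  let ?O = "\<lambda>U. U \<subseteq> carrier (davis_Aut W S) \<and>
     (\<forall>f\<in>U. \<exists>F. finite F \<and> F \<subseteq> davis_cells W S \<and> ?P f F \<subseteq> U)"
  have anti: "?P f F' \<subseteq> ?P f F" if "F \<subseteq> F'" for f F F'
    using that by (auto simp: l_coset_def pointwise_stabiliser_def)
  have "istopology ?O"
    unfolding istopology_def
  proof (intro conjI allI impI)
    fix U V assume U: "?O U" and V: "?O V"
    show "U \<inter> V \<subseteq> carrier (davis_Aut W S)" using U by blast
    show "\<forall>f\<in>U \<inter> V. \<exists>F. finite F \<and> F \<subseteq> davis_cells W S \<and> ?P f F \<subseteq> U \<inter> V"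
    proof
      fix f assume f: "f \<in> U \<inter> V"
      obtain F where F: "finite F" "F \<subseteq> davis_cells W S" "?P f F \<subseteq> U" using U f by blast
      obtain F' where F': "finite F'" "F' \<subseteq> davis_cells W S" "?P f F' \<subseteq> V" using V f by blast
      have "?P f (F \<union> F') \<subseteq> U \<inter> V"
        using anti[of F "F \<union> F'" f] anti[of F' "F \<union> F'" f] F(3) F'(3) by blast
      then show "\<exists>F. finite F \<and> F \<subseteq> davis_cells W S \<and> ?P f F \<subseteq> U \<inter> V"
        using F F' by (intro exI[of _ "F \<union> F'"]) auto
    qed
  next
    fix K assume K: "\<forall>U\<in>K. ?O U"
    show "\<Union>K \<subseteq> carrier (davis_Aut W S)" using K by blast
    show "\<forall>f\<in>\<Union>K. \<exists>F. finite F \<and> F \<subseteq> davis_cells W S \<and> ?P f F \<subseteq> \<Union>K"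
      using K by (meson Union_iff Union_upper subset_trans)
  qed
  then show ?thesis by (simp add: davis_Aut_topology_def)
qed


section \<open>Internal semidirect products\<close>

definition internal_semidirect_product ::
  "('a, 'b) monoid_scheme \<Rightarrow> 'a set \<Rightarrow> 'a set \<Rightarrow> bool" where
  "internal_semidirect_product G N H \<longleftrightarrow>
     N \<lhd> G \<and> subgroup H G \<and> N \<inter> H = {\<one>\<^bsub>G\<^esub>} \<and> N <#>\<^bsub>G\<^esub> H = carrier G"

end

theory Submission
  imports Defs
begin

text \<open>
  A poset automorphism of the Davis complex is induced by a bijection $h$ of $W$. At each $w \in W$
  it permutes the generators by $\pi_w$, where $h(ws) = h(w)\,\pi_w(s)$, and $\pi_w$ is a diagram
  automorphism. The dihedral cells that contain $w$ and $ws$ force $\pi_{ws}$ and $\pi_w$ to agree on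
  $s$ and on its neighbours, so if the diagram is not flexible, then $\pi$ is constant and $h$ is a left
  multiplication composed with a diagram automorphism. If all automorphisms have this form, then
  fixing $1$ and the generators forces the identity, so $\operatorname{Aut}(\Sigma)$ is discrete.

  Conversely, let $\phi$ be nontrivial and fix $s$ and its neighbours. Then $W$ is the amalgam of
  $W_{\mathrm{star}(s)}$ and $W_{S - s}$ over $W_{\mathrm{link}(s)}$. Every cell that is not contained in
  $W_{\mathrm{star}(s)}$ lies in a single branch of the corresponding tree at the vertex
  $W_{\mathrm{star}(s)}$, so applying $\phi$ outside one branch and the identity on that branch is
  an automorphism. Translates of this branch contain any given finite set of cells.
\<close>

section \<open>Coxeter groups\<close>

text \<open>The group theory rests on one invariant: \<open>odd_refl\<close> records modulo 2 how
  often a word crosses each reflection. It respects the Coxeter relations, so it depends only on the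
  element that the word represents. Deletion, the equality of $T$ and the set of generators in
  $W_T$, and the fact that two left descents $s$, $t$ force $st$ to have finite order are all read
  off from it. The last fact carries the amalgam structure. No tree is built: a branch is a set of
  group elements described through left descents, and the point is that it can be left only from
  $W_{link(s)}$ across an edge of type $s$. Such an exit is tied to generators at finite order with
  $s$, which is why a cell on the border of a branch lies in $W_{star(s)}$, where the extension of
  the diagram automorphism is the identity. A generator $r$ moved by the diagram automorphism is not
  joined to $s$, so $rs$ has infinite order; its powers are the translations that carry a finite set
  into the branch.\<close>

context group begin

section \<open>Words and the reflections that they cross\<close>

definition wprod :: "'a list \<Rightarrow> 'a" where
  "wprod u = foldr (\<otimes>) u \<one>"

lemma wprod_Nil [simp]: "wprod [] = \<one>"
  and wprod_Cons [simp]: "wprod (s # u) = s \<otimes> wprod u"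
  by (simp_all add: wprod_def)

lemma wprod_closed [simp]: "u \<in> lists (carrier G) \<Longrightarrow> wprod u \<in> carrier G"
  by (induction u) auto

lemma wprod_append [simp]:
  "u \<in> lists (carrier G) \<Longrightarrow> v \<in> lists (carrier G) \<Longrightarrow> wprod (u @ v) = wprod u \<otimes> wprod v"
  by (induction u) (auto simp: m_assoc)

lemma wprod_in_generate: "u \<in> lists T \<Longrightarrow> wprod u \<in> generate G T"
  by (induction u) (auto intro: generate.intros)

lemma finite_subgroup_order:
  assumes "finite H" "subgroup H G" "x \<in> H" shows "ord x \<noteq> 0"
proof -
  interpret H: group "G\<lparr>carrier := H\<rparr>" using assms(2) by (rule subgroup_imp_group)
  have "x [^] order (G\<lparr>carrier := H\<rparr>) = \<one>"
    using H.pow_order_eq_1[of x] assms by (simp flip: nat_pow_consistent)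
  moreover have "order (G\<lparr>carrier := H\<rparr>) > 0"
    using assms H.order_gt_0_iff_finite by simp
  ultimately show ?thesis
    using assms ord_eq_0[of x] by (auto dest: subgroup.mem_carrier)
qed

lemma mem_coset_iff:
  assumes "subgroup H G" "w \<in> carrier G" "x \<in> carrier G"
  shows "x \<in> w <# H \<longleftrightarrow> inv w \<otimes> x \<in> H"
proof
  assume "x \<in> w <# H"
  then obtain h where "h \<in> H" "x = w \<otimes> h" by (auto simp: l_coset_def)
  then show "inv w \<otimes> x \<in> H" using assms by (simp add: subgroup.mem_carrier flip: m_assoc)
next
  assume "inv w \<otimes> x \<in> H"
  moreover have "x = w \<otimes> (inv w \<otimes> x)" using assms by (simp flip: m_assoc)
  ultimately show "x \<in> w <# H" by (auto simp: l_coset_def)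
qed

lemma mult_mem_coset_iff:
  assumes "subgroup H G" "w \<in> carrier G" "x \<in> carrier G"
  shows "w \<otimes> x \<in> w <# H \<longleftrightarrow> x \<in> H"
  using assms by (simp add: mem_coset_iff flip: m_assoc)

text \<open>
  For a word $s_1 \cdots s_k$ this is the parity of the number of indices $i$ with
  $r = s_1 \cdots s_{i-1} s_i s_{i-1}^{-1} \cdots s_1^{-1}$.
\<close>

primrec odd_refl :: "'a list \<Rightarrow> 'a \<Rightarrow> bool" where
  "odd_refl [] r \<longleftrightarrow> False"
| "odd_refl (s # u) r \<longleftrightarrow> (r = s) \<noteq> odd_refl u (inv s \<otimes> r \<otimes> s)"

text \<open>The cocycle rule: reflections crossed by the second word are seen from the endpoint of
  the first, hence the conjugation by \<open>wprod u\<close>.\<close>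

lemma odd_refl_append:
  assumes "u \<in> lists (carrier G)" "v \<in> lists (carrier G)" "r \<in> carrier G"
  shows "odd_refl (u @ v) r \<longleftrightarrow> odd_refl u r \<noteq> odd_refl v (inv (wprod u) \<otimes> r \<otimes> wprod u)"
  using assms
proof (induction u arbitrary: r)
  case (Cons s u)
  have "inv (wprod u) \<otimes> (inv s \<otimes> r \<otimes> s) \<otimes> wprod u = inv (s \<otimes> wprod u) \<otimes> r \<otimes> (s \<otimes> wprod u)"
    using Cons.hyps Cons.prems by (simp add: m_assoc inv_mult_group)
  with Cons show ?case by auto
qed simp

end

primrec alt :: "'a \<Rightarrow> 'a \<Rightarrow> nat \<Rightarrow> 'a list" where
  "alt s t 0 = []"
| "alt s t (Suc n) = s # alt t s n"

lemma alt_in_lists: "s \<in> T \<Longrightarrow> t \<in> T \<Longrightarrow> alt s t n \<in> lists T"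
  by (induction n arbitrary: s t) auto

lemma alt_double: "alt s t (2 * n) = concat (replicate n [s, t])"
  by (induction n) auto

lemma map_alt: "map f (alt s t n) = alt (f s) (f t) n"
  by (induction n arbitrary: s t) auto

lemma take_alt: "take i (alt s t n) = alt s t (min i n)"
proof (induction n arbitrary: s t i)
  case (Suc n)
  then show ?case by (cases i) auto
qed simp

lemma (in group) wprod_alt_even:
  assumes "s \<in> carrier G" "t \<in> carrier G"
  shows "wprod (alt s t (2 * n)) = (s \<otimes> t) [^] n"
proof (induction n)
  case (Suc n)
  then have "wprod (alt s t (2 * Suc n)) = (s \<otimes> t) \<otimes> (s \<otimes> t) [^] n"
    using assms by (simp add: m_assoc)
  also have "\<dots> = (s \<otimes> t) [^] Suc n"
    using assms by (intro nat_pow_Suc2[symmetric] m_closed)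
  finally show ?case .
qed simp

section \<open>Words modulo the Coxeter relations\<close>

locale coxeter_group = group W for W (structure) +
  fixes S
  assumes system: "coxeter_system W S"
begin

lemma S_carrier: "S \<subseteq> carrier W"
  and generate_S: "generate W S = carrier W"
  and eval_word_eq_iff: "u \<in> words_over S \<Longrightarrow> v \<in> words_over S \<Longrightarrow>
    eval_word W u = eval_word W v \<longleftrightarrow> pres_equiv S (cox_relators W S) u v"
  using system by (auto simp: coxeter_system_def has_presentation_def)

lemma S_closed [simp]: "s \<in> S \<Longrightarrow> s \<in> carrier W"
  using S_carrier by blast

lemma lists_S_closed: "u \<in> lists S \<Longrightarrow> u \<in> lists (carrier W)"
  using S_carrier lists_mono by blast

lemma parabolic_closed: "T \<subseteq> S \<Longrightarrow> x \<in> generate W T \<Longrightarrow> x \<in> carrier W"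
  using generate_in_carrier S_carrier by blast

lemma involution [simp]: assumes "s \<in> S" shows "s \<otimes> s = \<one>"
proof -
  let ?r = "[(s, True), (s, True)]"
  have "pres_equiv S (cox_relators W S) ([] @ ?r @ []) ([] @ [])"
    by (rule pres_equiv.relator) (use assms in \<open>auto simp: words_over_def cox_relators_def\<close>)
  then have "eval_word W ?r = eval_word W []"
    using assms by (subst eval_word_eq_iff) (auto simp: words_over_def)
  then show ?thesis using assms by (simp add: eval_word_def)
qed

lemma inv_S [simp]: "s \<in> S \<Longrightarrow> inv s = s"
  by (simp add: inv_equality)

lemma cancel_S [simp]: "s \<in> S \<Longrightarrow> x \<in> carrier W \<Longrightarrow> s \<otimes> (s \<otimes> x) = x"
  by (simp flip: m_assoc)

lemma map_fst_words: "u \<in> words_over S \<Longrightarrow> map fst u \<in> lists S"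
  by (induction u) (auto simp: words_over_def)

lemma eval_word_wprod: "u \<in> words_over S \<Longrightarrow> eval_word W u = wprod (map fst u)"
  by (induction u) (auto simp: words_over_def eval_word_def)

text \<open>The strength of the presentation: a function on words that survives the insertion of
  relators is a function on $W$. Words without signs suffice because generators are involutions. It
  is applied to reflection parities and to letterwise substitution by a diagram
  automorphism.\<close>

lemma word_invariant:
  assumes eq: "wprod u = wprod v" and u: "u \<in> lists S" and v: "v \<in> lists S"
    and sq: "\<And>s x y. s \<in> S \<Longrightarrow> x \<in> lists S \<Longrightarrow> y \<in> lists S \<Longrightarrow> g (x @ [s, s] @ y) = g (x @ y)"
    and braid: "\<And>s t x y. s \<in> S \<Longrightarrow> t \<in> S \<Longrightarrow> s \<noteq> t \<Longrightarrow> x \<in> lists S \<Longrightarrow> y \<in> lists S \<Longrightarrow>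
      ord (s \<otimes> t) \<noteq> 0 \<Longrightarrow> g (x @ alt s t (2 * ord (s \<otimes> t)) @ y) = g (x @ y)"
  shows "g u = g v"
proof -
  \<comment> \<open>Forgetting signs turns a free cancellation into the removal of a square,
    whichever sign comes first.\<close>
  have g: "g (map fst x) = g (map fst y)" if "pres_equiv S (cox_relators W S) x y" for x y
    using that
  proof induction
    case (cancel u v s b)
    have "map fst u \<in> lists S" "map fst v \<in> lists S"
      using cancel map_fst_words by auto
    then show ?case using sq cancel by simp
  next
    case (relator u v r)
    have uv: "map fst u \<in> lists S" "map fst v \<in> lists S"
      using relator map_fst_words by auto
    from \<open>r \<in> cox_relators W S\<close> consider s where "s \<in> S" "r = [(s, True), (s, True)]"
      | s t k where "s \<in> S" "t \<in> S" "s \<noteq> t" "cox_order W s t = enat k"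
          "r = concat (replicate k [(s, True), (t, True)])"
      by (auto simp: cox_relators_def)
    then show ?case
    proof cases
      case 1
      then show ?thesis using sq[OF _ uv] by simp
    next
      case 2
      then have k: "ord (s \<otimes> t) \<noteq> 0" "k = ord (s \<otimes> t)"
        by (auto simp: cox_order_def split: if_splits)
      have "map fst r = alt s t (2 * k)"
        by (simp add: 2 map_alt flip: alt_double)
      then show ?thesis using braid[OF 2(1-3) uv] k by simp
    qed
  qed auto
  define sgn where "sgn = map (\<lambda>s::'a. (s, True))"
  have "sgn x \<in> words_over S" "map fst (sgn x) = x" if "x \<in> lists S" for x
    using that by (auto simp: words_over_def sgn_def o_def)
  then show ?thesis
    using g[of "sgn u" "sgn v"] eq u v by (simp flip: eval_word_eq_iff add: eval_word_wprod)
qed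

text \<open>The letter with index $i$, counted from 0, of an alternating word crosses the reflection
  $(st)^i s$. Removing the first letter exchanges $s$ and $t$ and conjugates by $s$, which shifts
  the exponent by one.\<close>

lemma odd_refl_alt:
  assumes "s \<in> S" "t \<in> S" "r \<in> carrier W"
  shows "odd_refl (alt s t n) r \<longleftrightarrow> odd (card {i. i < n \<and> (s \<otimes> t) [^] i \<otimes> s = r})"
  using assms
proof (induction n arbitrary: s t r)
  case (Suc n)
  have pow: "s \<otimes> ((t \<otimes> s) [^] i \<otimes> t) \<otimes> s = (s \<otimes> t) [^] Suc i \<otimes> s" for i
  proof (induction i)
    case (Suc i)
    have "s \<otimes> ((t \<otimes> s) [^] Suc i \<otimes> t) \<otimes> s = s \<otimes> ((t \<otimes> s) [^] i \<otimes> t) \<otimes> s \<otimes> t \<otimes> s"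
      using Suc.prems \<open>s \<in> S\<close> \<open>t \<in> S\<close> by (simp add: m_assoc)
    then show ?case using Suc \<open>s \<in> S\<close> \<open>t \<in> S\<close> by (simp add: m_assoc)
  qed (use \<open>s \<in> S\<close> \<open>t \<in> S\<close> in simp)
  have conj: "(t \<otimes> s) [^] i \<otimes> t = s \<otimes> r \<otimes> s \<longleftrightarrow> (s \<otimes> t) [^] Suc i \<otimes> s = r" for i
  proof
    assume "(t \<otimes> s) [^] i \<otimes> t = s \<otimes> r \<otimes> s"
    then have "s \<otimes> ((t \<otimes> s) [^] i \<otimes> t) \<otimes> s = s \<otimes> (s \<otimes> r \<otimes> s) \<otimes> s" by simp
    also have "\<dots> = r" using Suc.prems by (simp add: m_assoc)
    finally show "(s \<otimes> t) [^] Suc i \<otimes> s = r" by (simp only: pow)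
  next
    assume "(s \<otimes> t) [^] Suc i \<otimes> s = r"
    then have "s \<otimes> r \<otimes> s = s \<otimes> (s \<otimes> ((t \<otimes> s) [^] i \<otimes> t) \<otimes> s) \<otimes> s" by (simp only: pow)
    then show "(t \<otimes> s) [^] i \<otimes> t = s \<otimes> r \<otimes> s" using Suc.prems by (simp add: m_assoc)
  qed
  have "{i. i < Suc n \<and> (s \<otimes> t) [^] i \<otimes> s = r} =
      (if r = s then {0} else {}) \<union> Suc ` {i. i < n \<and> (s \<otimes> t) [^] Suc i \<otimes> s = r}"
    (is "?A = ?B \<union> Suc ` ?C")
  proof (rule Set.set_eqI)
    fix i show "i \<in> ?A \<longleftrightarrow> i \<in> ?B \<union> Suc ` ?C"
      using Suc.prems by (cases i) (auto simp del: nat_pow_Suc)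
  qed
  also have "card (?B \<union> Suc ` ?C) = card ?B + card ?C"
    by (subst card_Un_disjoint) (auto simp: card_image)
  finally have "odd (card ?A) \<longleftrightarrow> (r = s) \<noteq> odd (card ?C)" by auto
  then show ?case using Suc.IH[of t s "s \<otimes> r \<otimes> s"] Suc.prems conj by simp
qed simp

text \<open>A square crosses the same reflection twice. The relator of length $2m$ crosses $(st)^i
  s$ for $i < 2m$, a sequence of period $m$, so every reflection is crossed an even number of
  times.\<close>

lemma odd_refl_cong:
  assumes "wprod u = wprod v" "u \<in> lists S" "v \<in> lists S" "r \<in> carrier W"
  shows "odd_refl u r = odd_refl v r"
proof (rule word_invariant[where g = "\<lambda>u. odd_refl u r", OF assms(1-3)])
  fix s x y assume "s \<in> S" "x \<in> lists S" "y \<in> lists S"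
  note s = this this(2,3)[THEN lists_S_closed]
  define q where "q = inv (wprod x) \<otimes> r \<otimes> wprod x"
  have q: "q \<in> carrier W" using s assms by (simp add: q_def)
  have "s \<otimes> q \<otimes> s = s \<longleftrightarrow> q = s"
  proof
    assume "s \<otimes> q \<otimes> s = s"
    then have "s \<otimes> (s \<otimes> q \<otimes> s) \<otimes> s = s \<otimes> s \<otimes> s" by simp
    then show "q = s" using s q by (simp add: m_assoc)
  qed (use s in simp)
  then have "odd_refl ([s, s] @ y) q = odd_refl y q"
    using s q by (auto simp: m_assoc)
  then show "odd_refl (x @ [s, s] @ y) r = odd_refl (x @ y) r"
    using s assms by (simp add: odd_refl_append q_def)
next
  fix s t x y assume "s \<in> S" "t \<in> S" "x \<in> lists S" "y \<in> lists S"
  note s = this this(3,4)[THEN lists_S_closed]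
  define m where "m = ord (s \<otimes> t)"
  define q where "q = inv (wprod x) \<otimes> r \<otimes> wprod x"
  have q: "q \<in> carrier W" using s assms by (simp add: q_def)
  have alt: "alt s t (2 * m) \<in> lists S" using s by (simp add: alt_in_lists)
  have one: "wprod (alt s t (2 * m)) = \<one>" using s by (simp add: wprod_alt_even m_def)
  let ?P = "\<lambda>i. (s \<otimes> t) [^] i \<otimes> s = q"
  have shift: "?P (m + i) \<longleftrightarrow> ?P i" for i
    using s by (simp add: m_def flip: nat_pow_mult)
  have "{i. i < 2 * m \<and> ?P i} = {i. i < m \<and> ?P i} \<union> (+) m ` {i. i < m \<and> ?P i}"
    (is "?A = ?B \<union> _")
  proof (rule Set.set_eqI)
    fix i show "i \<in> ?A \<longleftrightarrow> i \<in> ?B \<union> (+) m ` ?B"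
    proof (cases "i < m")
      case False
      then obtain j where "i = m + j" using le_Suc_ex not_less by blast
      then show ?thesis by (auto simp: shift)
    qed auto
  qed
  also have "card \<dots> = card ?B + card ?B"
    by (subst card_Un_disjoint) (auto simp: card_image)
  finally have "\<not> odd_refl (alt s t (2 * m)) q"
    using s q by (simp add: odd_refl_alt)
  then have "odd_refl (alt s t (2 * m) @ y) q = odd_refl y q"
    using s q alt[THEN lists_S_closed] one by (simp add: odd_refl_append)
  then show "odd_refl (x @ alt s t (2 * ord (s \<otimes> t)) @ y) r = odd_refl (x @ y) r"
    using s assms alt[THEN lists_S_closed] by (simp add: odd_refl_append q_def flip: m_def)
qed

text \<open>The exchange condition: an odd count is nonzero, so $r$ is the reflection crossed at
  some letter, and multiplying by $r$ on the left erases that letter.\<close>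

lemma deletion:
  assumes "odd_refl u r" "u \<in> lists S" "r \<in> carrier W"
  shows "\<exists>x t y. u = x @ t # y \<and> r \<otimes> wprod u = wprod (x @ y) \<and>
    r = wprod x \<otimes> t \<otimes> inv (wprod x)"
  using assms
proof (induction u arbitrary: r)
  case (Cons s u)
  have s: "s \<in> S" "u \<in> lists S" "wprod u \<in> carrier W"
    using Cons.prems lists_S_closed by auto
  show ?case
  proof (cases "r = s")
    case True
    then show ?thesis using s by (intro exI[of _ "[]"] exI[of _ s] exI[of _ u]) simp
  next
    case False
    then have "odd_refl u (s \<otimes> r \<otimes> s)" using Cons.prems s by simp
    then obtain x t y where u: "u = x @ t # y"
      and del: "s \<otimes> r \<otimes> s \<otimes> wprod u = wprod (x @ y)"
      and srs: "s \<otimes> r \<otimes> s = wprod x \<otimes> t \<otimes> inv (wprod x)"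
      using Cons.IH[of "s \<otimes> r \<otimes> s"] Cons.prems s by auto
    have x: "wprod x \<in> carrier W" "t \<in> S"
      using s u lists_S_closed by auto
    have "r \<otimes> wprod (s # u) = s \<otimes> (s \<otimes> r \<otimes> s \<otimes> wprod u)"
      using Cons.prems s by (simp add: m_assoc)
    then have "r \<otimes> wprod (s # u) = wprod ((s # x) @ y)" using del by simp
    moreover have "r = s \<otimes> (s \<otimes> r \<otimes> s) \<otimes> s" using Cons.prems s by (simp add: m_assoc)
    then have "r = wprod (s # x) \<otimes> t \<otimes> inv (wprod (s # x))"
      unfolding srs using s x by (simp add: m_assoc inv_mult_group)
    ultimately show ?thesis using u by (metis append_Cons)
  qed
qed simp

lemma parabolic_word:
  assumes "T \<subseteq> S" "x \<in> generate W T"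
  shows "\<exists>u\<in>lists T. wprod u = x"
  using assms(2)
proof induction
  case one
  then show ?case by (auto intro: bexI[of _ "[]"])
next
  case (incl h)
  then show ?case using assms by (intro bexI[of _ "[h]"]) auto
next
  case (inv h)
  then show ?case using assms by (intro bexI[of _ "[h]"]) auto
next
  case (eng g h)
  then obtain u v where "u \<in> lists T" "wprod u = g" "v \<in> lists T" "wprod v = h" by blast
  moreover have "lists T \<subseteq> lists (carrier W)" using assms S_carrier lists_mono by blast
  ultimately show ?case by (intro bexI[of _ "u @ v"]) (auto simp: in_mono)
qed

section \<open>Inversions and parabolic subgroups\<close>

text \<open>The chosen word is immaterial by \<open>odd_refl_cong\<close>. For \<open>r\<close> in
  \<open>S\<close> this says that \<open>r\<close> is a left descent of \<open>w\<close>.\<close>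

definition inversion :: "'a \<Rightarrow> 'a \<Rightarrow> bool" where
  "inversion w r \<longleftrightarrow> odd_refl (SOME u. u \<in> lists S \<and> wprod u = w) r"

lemma word_exists: assumes "w \<in> carrier W" obtains u where "u \<in> lists S" "wprod u = w"
  using parabolic_word[of S w] assms generate_S by auto

lemma inversion_wprod:
  assumes "u \<in> lists S" "r \<in> carrier W"
  shows "inversion (wprod u) r \<longleftrightarrow> odd_refl u r"
proof -
  let ?v = "SOME v. v \<in> lists S \<and> wprod v = wprod u"
  have "?v \<in> lists S \<and> wprod ?v = wprod u"
    by (rule someI[of _ u]) (use assms in simp)
  then show ?thesis unfolding inversion_def using assms odd_refl_cong by blast
qed

lemma inversion_one [simp]: "r \<in> carrier W \<Longrightarrow> \<not> inversion \<one> r"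
  using inversion_wprod[of "[]" r] by simp

lemma inversion_S [simp]: "s \<in> S \<Longrightarrow> r \<in> carrier W \<Longrightarrow> inversion s r \<longleftrightarrow> r = s"
  using inversion_wprod[of "[s]" r] by simp

lemma inversion_mult:
  assumes "x \<in> carrier W" "y \<in> carrier W" "r \<in> carrier W"
  shows "inversion (x \<otimes> y) r \<longleftrightarrow> inversion x r \<noteq> inversion y (inv x \<otimes> r \<otimes> x)"
proof -
  obtain u v where uv: "u \<in> lists S" "wprod u = x" "v \<in> lists S" "wprod v = y"
    using assms word_exists by metis
  then have "odd_refl (u @ v) r \<longleftrightarrow> odd_refl u r \<noteq> odd_refl v (inv x \<otimes> r \<otimes> x)"
    using odd_refl_append[of u v r] assms lists_S_closed by blast
  then show ?thesis
    using uv assms inversion_wprod[of u r] inversion_wprod[of v "inv x \<otimes> r \<otimes> x"]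
      inversion_wprod[of "u @ v" r] lists_S_closed by simp
qed

lemma inversion_mult_left:
  "s \<in> S \<Longrightarrow> w \<in> carrier W \<Longrightarrow> inversion (s \<otimes> w) s \<longleftrightarrow> \<not> inversion w s"
  using inversion_mult[of s w s] by simp

text \<open>Passing from $x$ to $xt$ crosses exactly one reflection, $x t x^{-1}$; the equation
  \<open>r \<otimes> x = x \<otimes> t\<close> says that \<open>r\<close> is this one.\<close>

lemma inversion_mult_right:
  assumes "x \<in> carrier W" "t \<in> S" "r \<in> carrier W"
  shows "inversion (x \<otimes> t) r \<longleftrightarrow> inversion x r \<noteq> (r \<otimes> x = x \<otimes> t)"
proof -
  have "inv x \<otimes> r \<otimes> x = t \<longleftrightarrow> r \<otimes> x = x \<otimes> t"
    using assms by (metis S_closed inv_closed inv_solve_left m_assoc m_closed)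
  then show ?thesis using inversion_mult[of x t r] assms by simp
qed

lemma S_nontrivial: "s \<in> S \<Longrightarrow> s \<noteq> \<one>"
  by (metis S_closed inversion_S inversion_one)

text \<open>The first letter of a shortest word over $T$ works: if the remaining letters crossed the
  same reflection, deletion would give a shorter word.\<close>

lemma parabolic_descent:
  assumes T: "T \<subseteq> S" and x: "x \<in> generate W T" "x \<noteq> \<one>"
  obtains t where "t \<in> T" "inversion x t"
proof -
  define u where "u = arg_min length (\<lambda>u. u \<in> lists T \<and> wprod u = x)"
  have u: "u \<in> lists T" "wprod u = x"
    and min: "\<And>v. v \<in> lists T \<Longrightarrow> wprod v = x \<Longrightarrow> length u \<le> length v"
    using parabolic_word[OF T x(1)]
      arg_min_nat_lemma[of "\<lambda>u. u \<in> lists T \<and> wprod u = x" _ length] unfolding u_def by blast+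
  have lT: "v \<in> lists S" if "v \<in> lists T" for v using that T lists_mono by blast
  obtain t v where tv: "u = t # v" using u x by (cases u) auto
  have t: "t \<in> T" "t \<in> S" "v \<in> lists T" using u tv T by auto
  have "\<not> odd_refl v t"
  proof
    assume "odd_refl v t"
    then obtain a s b where ab: "v = a @ s # b" "t \<otimes> wprod v = wprod (a @ b)"
      using deletion[of v t] lT t by auto
    then show False using min[of "a @ b"] tv t u by auto
  qed
  then have "odd_refl u t" using tv t by simp
  then have "inversion x t" using inversion_wprod[of u t] u lT t by simp
  with t show ?thesis using that by blast
qed

text \<open>The only generator that is an inversion of $q$ is $q$ itself, and some element of $T$ is
  one.\<close>

lemma parabolic_generators:
  assumes "T \<subseteq> S" "q \<in> S" "q \<in> generate W T" shows "q \<in> T"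
  using parabolic_descent[OF assms(1,3) S_nontrivial[OF assms(2)]] assms
  by (metis S_closed inversion_S subsetD)

text \<open>Deletion writes $q$ as a conjugate of a letter from $T$ by an element of $W_T$, so $q$
  lies in $W_T$ and the previous lemma applies.\<close>

lemma parabolic_inversion:
  assumes T: "T \<subseteq> S" and x: "x \<in> generate W T" and q: "q \<in> S" "inversion x q"
  shows "q \<in> T"
proof -
  obtain u where u: "u \<in> lists T" "wprod u = x" using parabolic_word T x by blast
  have lT: "v \<in> lists S" if "v \<in> lists T" for v using that T lists_mono by blast
  have "odd_refl u q" using inversion_wprod[of u q] lT u q by simp
  then obtain a t b where ab: "u = a @ t # b" "q = wprod a \<otimes> t \<otimes> inv (wprod a)"
    using deletion[of u q] lT u q by auto
  have "wprod a \<in> generate W T" using u ab by (auto intro: wprod_in_generate)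
  then have "q \<in> generate W T"
    unfolding ab(2) using ab(1) u T S_carrier
    by (intro generate.eng generate_m_inv_closed) (auto intro: generate.incl)
  then show ?thesis using parabolic_generators T q by blast
qed

section \<open>Dihedral subgroups\<close>

lemma dihedral_alt:
  assumes "s \<in> S" "t \<in> S" "d \<in> generate W {s, t}"
  shows "\<exists>n. d = wprod (alt s t n) \<or> d = wprod (alt t s n)"
proof -
  let ?A = "\<lambda>d. \<exists>n. d = wprod (alt s t n) \<or> d = wprod (alt t s n)"
  have step: "?A (p \<otimes> d)" if p: "p = s \<and> q = t \<or> p = t \<and> q = s" and d: "?A d" for p q d
  proof -
    have S: "p \<in> S" "q \<in> S" using p assms by auto
    have closed: "wprod (alt q p n) \<in> carrier W" for n
      using S by (intro wprod_closed lists_S_closed alt_in_lists)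
    consider n where "d = wprod (alt q p n)" | n where "d = wprod (alt p q n)"
      using p d by auto
    then show ?thesis
    proof cases
      case 1
      then have "p \<otimes> d = wprod (alt p q (Suc n))" by simp
      then show ?thesis using p by blast
    next
      case 2
      show ?thesis
      proof (cases n)
        case 0
        then have "p \<otimes> d = wprod (alt p q (Suc 0))" using 2 by simp
        then show ?thesis using p by blast
      next
        case (Suc m)
        then have "p \<otimes> d = wprod (alt q p m)" using 2 S closed by simp
        then show ?thesis using p by blast
      qed
    qed
  qed
  have "?A (wprod u)" if "u \<in> lists {s, t}" for u
    using that
  proof (induction u)
    case Nil
    then show ?case by (auto intro: exI[of _ 0])
  next
    case (Cons a u)
    then show ?case using step[of s t "wprod u"] step[of t s "wprod u"] by auto
  qed
  then show ?thesis using parabolic_word[of "{s, t}" d] assms by blast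
qed

text \<open>When $st$ has infinite order (encoded by \<open>ord\<close> being 0) the reflections
  $(st)^i s$ are pairwise distinct. None of them equals $t$, and $s$ occurs only at $i = 0$.\<close>

lemma inversion_alt_infinite:
  assumes s: "s \<in> S" "t \<in> S" and ord: "ord (s \<otimes> t) = 0"
  shows "\<not> inversion (wprod (alt s t n)) t"
    and "n > 0 \<Longrightarrow> inversion (wprod (alt s t n)) s"
proof -
  have pow: "(s \<otimes> t) [^] i = \<one> \<longleftrightarrow> i = 0" for i :: nat
    using ord s ord_eq_0[of "s \<otimes> t"] by auto
  have alt: "alt s t n \<in> lists S" using s by (rule alt_in_lists)
  have "(s \<otimes> t) [^] i \<otimes> s = t \<longleftrightarrow> (s \<otimes> t) [^] Suc i = \<one>" for i :: nat
  proof
    assume "(s \<otimes> t) [^] i \<otimes> s = t"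
    then have "(s \<otimes> t) [^] i \<otimes> s \<otimes> t = \<one>" using s by simp
    then show "(s \<otimes> t) [^] Suc i = \<one>" using s by (simp add: m_assoc)
  next
    assume "(s \<otimes> t) [^] Suc i = \<one>"
    then have "(s \<otimes> t) [^] i \<otimes> s \<otimes> t = \<one>" using s by (simp add: m_assoc)
    then show "(s \<otimes> t) [^] i \<otimes> s = t" using s inv_equality[of "(s \<otimes> t) [^] i \<otimes> s" t] by simp
  qed
  then have "(s \<otimes> t) [^] i \<otimes> s \<noteq> t" for i :: nat
    using pow[of "Suc i"] by blast
  then have none: "{i. i < n \<and> (s \<otimes> t) [^] i \<otimes> s = t} = {}" by simp
  show "\<not> inversion (wprod (alt s t n)) t"
    using s alt by (simp add: inversion_wprod odd_refl_alt none)
  have "(s \<otimes> t) [^] i \<otimes> s = s \<longleftrightarrow> i = 0" for i :: nat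
    using s pow[of i] by simp
  then have "{i. i < n \<and> (s \<otimes> t) [^] i \<otimes> s = s} = {0}" if "n > 0"
    using that by auto
  then show "inversion (wprod (alt s t n)) s" if "n > 0"
    using that s alt by (simp add: inversion_wprod odd_refl_alt)
qed

text \<open>
  Write $w = d w_0$ with $w_0$ shortest in $\langle s, t\rangle w$: then $w_0$ has no inversion in
  $\langle s, t\rangle$, so the inversions of $w$ there are those of the alternating word $d$.
\<close>

lemma two_descents_finite_order:
  assumes s: "s \<in> S" "t \<in> S" and w: "w \<in> carrier W" "inversion w s" "inversion w t"
  shows "ord (s \<otimes> t) \<noteq> 0"
proof
  assume ord: "ord (s \<otimes> t) = 0"
  have D: "subgroup (generate W {s, t}) W" using s by (intro generate_is_subgroup) auto
  define P where "P u \<longleftrightarrow> u \<in> lists S \<and> (\<exists>d\<in>generate W {s, t}. w = d \<otimes> wprod u)" for u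
  obtain u1 where "u1 \<in> lists S" "wprod u1 = w" using w word_exists by blast
  then have "P u1" using w by (auto simp: P_def intro!: bexI[of _ \<one>] generate.one)
  define u where "u = arg_min length P"
  have u: "P u" and min: "\<And>v. P v \<Longrightarrow> length u \<le> length v"
    using arg_min_nat_lemma[of P u1 length] \<open>P u1\<close> unfolding u_def by auto
  obtain d where d: "d \<in> generate W {s, t}" "w = d \<otimes> wprod u" and uS: "u \<in> lists S"
    using u by (auto simp: P_def)
  have dW: "d \<in> carrier W" and uW: "wprod u \<in> carrier W"
    using d s parabolic_closed[of "{s, t}"] uS lists_S_closed by auto
  \<comment> \<open>Deleting the letter at $r$ would shorten $u$ without leaving the coset, against
    the minimal choice of \<open>u\<close>.\<close>
  have no: "\<not> inversion (wprod u) r" if r: "r \<in> generate W {s, t}" for r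
  proof
    assume inv: "inversion (wprod u) r"
    have rW: "r \<in> carrier W" using r s parabolic_closed[of "{s, t}"] by auto
    obtain a p b where ab: "u = a @ p # b" "r \<otimes> wprod u = wprod (a @ b)"
      using deletion[of u r] inv rW uS by (auto simp: inversion_wprod)
    have "inv r \<otimes> (r \<otimes> wprod u) = wprod u" using rW uW by (simp flip: m_assoc)
    then have "w = d \<otimes> inv r \<otimes> (r \<otimes> wprod u)"
      using d rW dW uW by (simp add: m_assoc)
    moreover have "d \<otimes> inv r \<in> generate W {s, t}"
      using d r D by (simp add: subgroup.m_closed subgroup.m_inv_closed)
    ultimately have "P (a @ b)" using ab uS by (auto simp: P_def)
    then show False using min ab by fastforce
  qed
  have "inversion w r \<longleftrightarrow> inversion d r" if r: "r \<in> {s, t}" for r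
  proof -
    have "inv d \<otimes> r \<otimes> d \<in> generate W {s, t}"
      using d r D by (simp add: subgroup.m_closed subgroup.m_inv_closed generate.incl)
    then show ?thesis using inversion_mult[OF dW uW, of r] no d r s by auto
  qed
  then have "inversion d s" "inversion d t" using w by auto
  \<comment> \<open>Needed by symmetry: $d$ may start with either letter, and it has no inversion at
    the letter with which it does not start.\<close>
  moreover have "ord (t \<otimes> s) = 0"
    using ord ord_inv[of "s \<otimes> t"] s by (simp add: inv_mult_group)
  ultimately show False
    using dihedral_alt[OF s d(1)] inversion_alt_infinite(1)[OF s ord]
      inversion_alt_infinite(1)[OF s(2,1)] by auto
qed

lemma dihedral_finite:
  assumes s: "s \<in> S" "t \<in> S" and ord: "ord (s \<otimes> t) \<noteq> 0"
  shows "finite (generate W {s, t})"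
proof -
  define m where "m = ord (s \<otimes> t)"
  have fin: "\<exists>n < 2 * k. wprod (alt p q i) = wprod (alt p q n)"
    if "p \<in> S" "q \<in> S" "(p \<otimes> q) [^] k = \<one>" "k > 0" for p q i k
  proof (induction i rule: less_induct)
    case (less i)
    show ?case
    proof (cases "i < 2 * k")
      case False
      then obtain j where j: "i = 2 * k + j" using le_Suc_ex not_less by blast
      have split: "alt p q (2 * k + j) = alt p q (2 * k) @ alt p q j" for k
        by (induction k) auto
      have "wprod (alt p q i) = wprod (alt p q (2 * k)) \<otimes> wprod (alt p q j)"
        unfolding j split using that(1,2)
        by (intro wprod_append lists_S_closed alt_in_lists)
      also have "\<dots> = wprod (alt p q j)"
        using that lists_S_closed alt_in_lists[of p S q] by (simp add: wprod_alt_even)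
      finally show ?thesis using less[of j] j \<open>k > 0\<close> by auto
    qed auto
  qed
  have "(s \<otimes> t) [^] m = \<one>" using s by (simp add: m_def)
  moreover have "ord (t \<otimes> s) = m"
    using ord_inv[of "s \<otimes> t"] s by (simp add: inv_mult_group m_def)
  then have "(t \<otimes> s) [^] m = \<one>" using s by (metis S_closed m_closed pow_ord_eq_1)
  moreover have "m > 0" using ord by (simp add: m_def)
  ultimately have "d \<in> (\<lambda>n. wprod (alt s t n)) ` {..<2 * m} \<union> (\<lambda>n. wprod (alt t s n)) ` {..<2 * m}"
    if "d \<in> generate W {s, t}" for d
    using dihedral_alt[OF s that] fin[OF s, of m] fin[OF s(2,1), of m] by fastforce
  then have "generate W {s, t} \<subseteq>
      (\<lambda>n. wprod (alt s t n)) ` {..<2 * m} \<union> (\<lambda>n. wprod (alt t s n)) ` {..<2 * m}"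
    by blast
  then show ?thesis by (rule finite_subset) auto
qed

end

section \<open>Automorphisms of the Davis complex\<close>

context coxeter_group begin

abbreviation "cells \<equiv> davis_cells W S"
abbreviation "Aut \<equiv> davis_Aut W S"

lemma spherical_subgroup: "spherical W S T \<Longrightarrow> subgroup (generate W T) W"
  using S_carrier by (intro generate_is_subgroup) (auto simp: spherical_def)

lemma cellI: "w \<in> carrier W \<Longrightarrow> spherical W S T \<Longrightarrow> w <# generate W T \<in> cells"
  by (auto simp: davis_cells_def)

lemma cell_at:
  assumes "A \<in> cells" "x \<in> A"
  obtains T where "spherical W S T" "A = x <# generate W T" "x \<in> carrier W"
proof -
  obtain w T where wT: "A = w <# generate W T" "w \<in> carrier W" "spherical W S T"
    using assms by (auto simp: davis_cells_def)
  then have "A = x <# generate W T"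
    using l_repr_independence spherical_subgroup assms(2) by metis
  moreover have "x \<in> carrier W"
    using wT assms(2) spherical_subgroup l_coset_carrier by blast
  ultimately show ?thesis using that wT by blast
qed

lemma cell_nonempty: "A \<in> cells \<Longrightarrow> A \<noteq> {}"
  by (auto simp: davis_cells_def l_coset_def intro: generate.one)

lemma cell_subset: "A \<in> cells \<Longrightarrow> A \<subseteq> carrier W"
  using cell_at by blast

lemma cell_finite: "A \<in> cells \<Longrightarrow> finite A"
  by (auto simp: davis_cells_def l_coset_def spherical_def)

lemma vertex_cell: assumes "w \<in> carrier W" shows "{w} \<in> cells"
proof -
  have "w <# generate W {} \<in> cells"
    using assms by (intro cellI) (auto simp: spherical_def generate_empty)
  then show ?thesis using assms by (simp add: generate_empty l_coset_def)
qed

lemma mem_Aut: "f \<in> carrier Aut \<longleftrightarrow>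
    f \<in> Bij cells \<and> (\<forall>A\<in>cells. \<forall>B\<in>cells. f A \<subseteq> f B \<longleftrightarrow> A \<subseteq> B)"
  by (simp add: davis_Aut_def)

lemma Aut_mult: "f \<in> carrier Aut \<Longrightarrow> g \<in> carrier Aut \<Longrightarrow> f \<otimes>\<^bsub>Aut\<^esub> g = compose cells f g"
  by (simp add: mem_Aut) (simp add: davis_Aut_def BijGroup_def)

lemma Aut_one: "\<one>\<^bsub>Aut\<^esub> = (\<lambda>A\<in>cells. A)"
  by (simp add: davis_Aut_def BijGroup_def)

lemma Aut_group: "group Aut"
proof -
  let ?B = "BijGroup cells"
  interpret B: group ?B by (rule group_BijGroup)
  have "subgroup (carrier Aut) ?B"
  proof (rule B.subgroupI)
    show "carrier Aut \<subseteq> carrier ?B" by (auto simp: mem_Aut BijGroup_def)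
    have "(\<lambda>A\<in>cells. A) \<in> carrier Aut" by (simp add: mem_Aut id_Bij)
    then show "carrier Aut \<noteq> {}" by blast
  next
    fix f assume f: "f \<in> carrier Aut"
    then have bij: "bij_betw f cells cells" by (simp add: mem_Aut Bij_def)
    have "inv_into cells f A \<subseteq> inv_into cells f B \<longleftrightarrow> A \<subseteq> B" if "A \<in> cells" "B \<in> cells" for A B
      using that f bij_betw_inv_into_right[OF bij] bij_betwE[OF bij_betw_inv_into[OF bij]]
      unfolding mem_Aut by metis
    then show "inv\<^bsub>?B\<^esub> f \<in> carrier Aut"
      using f by (simp add: mem_Aut inv_BijGroup restrict_inv_into_Bij)
  next
    fix f g assume fg: "f \<in> carrier Aut" "g \<in> carrier Aut"
    then have "g A \<in> cells" if "A \<in> cells" for A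
      using that by (auto simp: mem_Aut dest: Bij_imp_funcset)
    with fg show "f \<otimes>\<^bsub>?B\<^esub> g \<in> carrier Aut"
      by (simp add: mem_Aut BijGroup_def compose_Bij compose_eq)
  qed
  then have "group (?B\<lparr>carrier := carrier Aut\<rparr>)" by (rule B.subgroup_imp_group)
  moreover have "?B\<lparr>carrier := carrier Aut\<rparr> = Aut" by (simp add: davis_Aut_def)
  ultimately show ?thesis by simp
qed

section \<open>Automorphisms as maps of the vertex set\<close>

text \<open>The equation, rather than an inclusion, puts surjectivity on cells into the definition;
  that inclusions are reflected then follows from injectivity on elements.\<close>

definition cellular :: "('a \<Rightarrow> 'a) \<Rightarrow> bool" where
  "cellular h \<longleftrightarrow> bij_betw h (carrier W) (carrier W) \<and> (\<lambda>A. h ` A) ` cells = cells"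

lemma cellular_bij: "cellular h \<Longrightarrow> bij_betw h (carrier W) (carrier W)"
  and cellular_image: "cellular h \<Longrightarrow> A \<in> cells \<Longrightarrow> h ` A \<in> cells"
  by (auto simp: cellular_def)

lemma cellular_closed: "cellular h \<Longrightarrow> x \<in> carrier W \<Longrightarrow> h x \<in> carrier W"
  using cellular_bij bij_betwE by blast

lemma cellular_eq_iff:
  "cellular h \<Longrightarrow> x \<in> carrier W \<Longrightarrow> y \<in> carrier W \<Longrightarrow> h x = h y \<longleftrightarrow> x = y"
  using cellular_bij by (metis bij_betw_def inj_on_eq_iff)

lemma induced_map_in_Aut: assumes "cellular h" shows "induced_map W S h \<in> carrier Aut"
proof -
  have inj: "inj_on h (carrier W)" using cellular_bij[OF assms] by (simp add: bij_betw_def)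
  have sub: "h ` A \<subseteq> h ` B \<longleftrightarrow> A \<subseteq> B" if "A \<in> cells" "B \<in> cells" for A B
    using inj_on_image_mem_iff[OF inj] that[THEN cell_subset] by blast
  then have "inj_on (\<lambda>A. h ` A) cells" by (intro inj_onI) blast
  then have "bij_betw (\<lambda>A. h ` A) cells cells"
    using assms by (auto simp: cellular_def bij_betw_def)
  then have "induced_map W S h \<in> Bij cells"
    by (simp add: induced_map_def Bij_def cong: bij_betw_cong)
  then show ?thesis using sub by (simp add: mem_Aut induced_map_def)
qed

lemma induced_map_vertex: "w \<in> carrier W \<Longrightarrow> induced_map W S h {w} = {h w}"
  by (simp add: induced_map_def vertex_cell)

lemma induced_map_cong:
  assumes "\<And>x. x \<in> carrier W \<Longrightarrow> g x = h x" shows "induced_map W S g = induced_map W S h"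
  unfolding induced_map_def using assms cell_subset by (intro restrict_ext image_cong) auto

lemma induced_map_eq_iff:
  "induced_map W S g = induced_map W S h \<longleftrightarrow> (\<forall>x\<in>carrier W. g x = h x)"
  by (metis induced_map_cong induced_map_vertex singleton_inject)

lemma induced_map_one: "\<one>\<^bsub>Aut\<^esub> = induced_map W S (\<lambda>x. x)"
  by (simp add: Aut_one induced_map_def)

lemma cellular_comp: assumes "cellular g" "cellular h" shows "cellular (g \<circ> h)"
proof -
  have "(\<lambda>A. (g \<circ> h) ` A) ` cells = (\<lambda>A. g ` A) ` (\<lambda>A. h ` A) ` cells"
    by (simp add: image_comp image_image)
  then show ?thesis using assms bij_betw_trans unfolding cellular_def by metis
qed

lemma induced_map_mult:
  assumes "cellular g" "cellular h"
  shows "induced_map W S g \<otimes>\<^bsub>Aut\<^esub> induced_map W S h = induced_map W S (g \<circ> h)"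
proof -
  have "induced_map W S g \<otimes>\<^bsub>Aut\<^esub> induced_map W S h =
      compose cells (induced_map W S g) (induced_map W S h)"
    using assms by (intro Aut_mult induced_map_in_Aut)
  also have "\<dots> = induced_map W S (g \<circ> h)"
    using cellular_image[OF assms(2)]
    by (simp add: compose_def induced_map_def image_comp cong: restrict_cong)
  finally show ?thesis .
qed

lemma cellular_inv:
  assumes "cellular h" shows "cellular (inv_into (carrier W) h)"
proof -
  have bij: "bij_betw h (carrier W) (carrier W)" using assms by (rule cellular_bij)
  have "inv_into (carrier W) h ` (h ` A) = A" if "A \<in> cells" for A
    using bij that cell_subset by (simp add: bij_betw_def inv_into_image_cancel)
  then have "(\<lambda>A. inv_into (carrier W) h ` A) ` ((\<lambda>A. h ` A) ` cells) = cells"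
    by (auto simp: image_image)
  then show ?thesis using assms by (simp add: cellular_def bij_betw_inv_into)
qed

lemma cellular_inv_cancel:
  assumes "cellular h" "x \<in> carrier W"
  shows "inv_into (carrier W) h (h x) = x" "h (inv_into (carrier W) h x) = x"
  using cellular_bij[OF assms(1)] assms(2)
  by (auto simp: bij_betw_inv_into_left bij_betw_inv_into_right)

text \<open>Singletons are the minimal cells, so an automorphism permutes them and defines
  \<open>h\<close>. A cell is the set of the singletons below it, so its image is determined by
  \<open>h\<close>.\<close>

lemma Aut_induced:
  assumes f: "f \<in> carrier Aut"
  obtains h where "cellular h" "f = induced_map W S h"
proof -
  have bij: "bij_betw f cells cells" and ext: "f \<in> extensional cells"
    and iso: "\<And>A B. A \<in> cells \<Longrightarrow> B \<in> cells \<Longrightarrow> f A \<subseteq> f B \<longleftrightarrow> A \<subseteq> B"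
    using f by (auto simp: mem_Aut Bij_def)
  have cell: "f A \<in> cells" if "A \<in> cells" for A using bij that bij_betwE by blast
  have vertex: "\<exists>x. f {w} = {x}" if w: "w \<in> carrier W" for w
  proof -
    obtain x where x: "x \<in> f {w}" using cell_nonempty cell vertex_cell w by blast
    \<comment> \<open>The preimage of a singleton below the image of \<open>{w}\<close> is a
      nonempty cell inside \<open>{w}\<close>, so it is \<open>{w}\<close> itself.\<close>
    then have "{x} \<in> cells" using cell_subset cell vertex_cell w by blast
    then obtain B where B: "B \<in> cells" "f B = {x}" using bij by (metis bij_betw_def imageE)
    then have "B \<subseteq> {w}" using x iso[of B "{w}"] vertex_cell w by simp
    then have "B = {w}" using cell_nonempty B by blast
    with B show ?thesis by blast
  qed
  define h where "h w = the_elem (f {w})" for w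
  have h: "f {w} = {h w}" if "w \<in> carrier W" for w
    using vertex[OF that] unfolding h_def by (metis the_elem_eq)
  have hW: "h w \<in> carrier W" if "w \<in> carrier W" for w
    using h[OF that] cell_subset[OF cell[OF vertex_cell[OF that]]] by simp
  have preimage: "\<exists>w\<in>carrier W. h w = x" if x: "x \<in> carrier W" for x
  proof -
    obtain B where B: "B \<in> cells" "f B = {x}"
      using bij vertex_cell[OF x] by (metis bij_betw_def imageE)
    then obtain w where w: "w \<in> B" "w \<in> carrier W" using cell_nonempty cell_subset by blast
    then have "f {w} \<subseteq> {x}" using iso[of "{w}" B] vertex_cell B by simp
    then show ?thesis using h w by auto
  qed
  have mem: "h w \<in> f A \<longleftrightarrow> w \<in> A" if "w \<in> carrier W" "A \<in> cells" for w A
    using iso[of "{w}" A] h[of w] that vertex_cell by simp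
  have image: "f A = h ` A" if A: "A \<in> cells" for A
  proof
    show "f A \<subseteq> h ` A"
      using mem[OF _ A] preimage cell_subset[OF cell[OF A]] by blast
    show "h ` A \<subseteq> f A" using mem[OF _ A] cell_subset[OF A] by blast
  qed
  have "inj_on h (carrier W)"
  proof (rule inj_onI)
    fix x y assume "x \<in> carrier W" "y \<in> carrier W" "h x = h y"
    then show "x = y" using mem[of x "{y}"] h[of y] vertex_cell by simp
  qed
  then have "bij_betw h (carrier W) (carrier W)"
    using hW preimage unfolding bij_betw_def by blast
  moreover have "(\<lambda>A. h ` A) ` cells = cells"
    using bij image by (metis bij_betw_def image_cong)
  ultimately have "cellular h" by (simp add: cellular_def)
  moreover have "f = induced_map W S h"
    using ext image
    by (intro HOL.ext) (simp add: induced_map_def extensional_def restrict_def)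
  ultimately show ?thesis using that by blast
qed

lemma cellular_left_mult: assumes "w \<in> carrier W" shows "cellular (\<lambda>x. w \<otimes> x)"
proof -
  have image: "(\<lambda>x. v \<otimes> x) ` A \<in> cells" if v: "v \<in> carrier W" and A: "A \<in> cells" for v A
  proof -
    obtain x T where xT: "A = x <# generate W T" "x \<in> carrier W" "spherical W S T"
      using A by (auto simp: davis_cells_def)
    have "(\<lambda>x. v \<otimes> x) ` A = v <# A" by (auto simp: l_coset_def)
    also have "\<dots> = (v \<otimes> x) <# generate W T"
      unfolding xT(1) using v xT(2) spherical_subgroup[OF xT(3)]
      by (intro lcos_m_assoc subgroup.subset)
    finally show ?thesis using cellI xT v by simp
  qed
  have "A \<in> (\<lambda>A. (\<lambda>x. w \<otimes> x) ` A) ` cells" if A: "A \<in> cells" for A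
  proof
    have "w \<otimes> (inv w \<otimes> x) = x" if "x \<in> A" for x
      using that assms cell_subset[OF A] by (auto simp flip: m_assoc)
    then show "A = (\<lambda>x. w \<otimes> x) ` (\<lambda>x. inv w \<otimes> x) ` A" by (auto simp: image_image)
    show "(\<lambda>x. inv w \<otimes> x) ` A \<in> cells" using image assms A by simp
  qed
  moreover have "bij_betw (\<lambda>x. w \<otimes> x) (carrier W) (carrier W)"
    by (intro bij_betwI[of _ _ _ "\<lambda>x. inv w \<otimes> x"]) (use assms in \<open>auto simp flip: m_assoc\<close>)
  ultimately show ?thesis unfolding cellular_def using image assms by blast
qed

section \<open>Diagram automorphisms and their action on the complex\<close>

definition order_preserving :: "('a \<Rightarrow> 'a) \<Rightarrow> bool" where
  "order_preserving \<phi> \<longleftrightarrow> bij_betw \<phi> S S \<and>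
     (\<forall>s\<in>S. \<forall>t\<in>S. s \<noteq> t \<longrightarrow> ord (\<phi> s \<otimes> \<phi> t) = ord (s \<otimes> t))"

lemma cox_order_eq_iff: "cox_order W s t = cox_order W s' t' \<longleftrightarrow> ord (s \<otimes> t) = ord (s' \<otimes> t')"
  by (auto simp: cox_order_def)

lemma diagram_edge_iff:
  "diagram_edge W S s t \<longleftrightarrow> s \<in> S \<and> t \<in> S \<and> s \<noteq> t \<and> ord (s \<otimes> t) \<noteq> 0"
  by (auto simp: diagram_edge_def cox_order_def)

text \<open>A missing edge stands for infinite order, that is for \<open>ord\<close> equal to 0.
  Preserving edges in both directions together with labels therefore preserves \<open>ord\<close> on
  all pairs of distinct generators.\<close>

lemma diagram_automorphism_iff: "diagram_automorphism W S \<phi> \<longleftrightarrow> order_preserving \<phi>"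
proof (cases "bij_betw \<phi> S S")
  case True
  then have "\<phi> s \<in> S" "\<phi> s = \<phi> t \<longleftrightarrow> s = t" if "s \<in> S" "t \<in> S" for s t
    using that by (auto simp: bij_betw_def inj_on_eq_iff)
  note \<phi> = this
  show ?thesis
  proof
    assume aut: "diagram_automorphism W S \<phi>"
    have "ord (\<phi> s \<otimes> \<phi> t) = ord (s \<otimes> t)" if st: "s \<in> S" "t \<in> S" "s \<noteq> t" for s t
    proof (cases "ord (s \<otimes> t) = 0")
      case True
      then have "\<not> diagram_edge W S (\<phi> s) (\<phi> t)"
        using aut st by (simp add: diagram_automorphism_def diagram_edge_iff)
      then show ?thesis using True \<phi> st by (simp add: diagram_edge_iff)
    next
      case False
      then have "diagram_edge W S s t" using st by (simp add: diagram_edge_iff)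
      then show ?thesis using aut by (simp add: diagram_automorphism_def cox_order_eq_iff)
    qed
    then show "order_preserving \<phi>" using True by (simp add: order_preserving_def)
  next
    assume "order_preserving \<phi>"
    then show "diagram_automorphism W S \<phi>"
      unfolding diagram_automorphism_def order_preserving_def diagram_edge_iff cox_order_eq_iff
      using \<phi> by (intro conjI ballI allI impI; force)
  qed
qed (simp add: diagram_automorphism_def order_preserving_def)

definition diagram_iso :: "('a \<Rightarrow> 'a) \<Rightarrow> bool" where
  "diagram_iso \<alpha> \<longleftrightarrow> \<alpha> \<in> iso W W \<and> order_preserving \<alpha>"

lemma diagram_auts_eq: "diagram_auts W S = {induced_map W S \<alpha> | \<alpha>. diagram_iso \<alpha>}"
proof -
  have "(\<exists>\<pi>. bij_betw \<pi> S S \<and> (\<forall>s\<in>S. \<forall>t\<in>S. s \<noteq> t \<longrightarrow> cox_order W (\<pi> s) (\<pi> t) = cox_order W s t) \<and>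
      (\<forall>s\<in>S. \<alpha> s = \<pi> s)) \<longleftrightarrow> order_preserving \<alpha>" (is "(\<exists>\<pi>. ?P \<pi>) \<longleftrightarrow> _") for \<alpha>
  proof
    assume "\<exists>\<pi>. ?P \<pi>"
    then obtain \<pi> where "?P \<pi>" ..
    then show "order_preserving \<alpha>"
      by (simp add: order_preserving_def cox_order_eq_iff cong: bij_betw_cong)
  next
    assume "order_preserving \<alpha>"
    then show "\<exists>\<pi>. ?P \<pi>"
      by (intro exI[of _ \<alpha>]) (simp add: order_preserving_def cox_order_eq_iff)
  qed
  then show ?thesis by (simp add: diagram_auts_def diagram_iso_def)
qed

lemma diagram_iso_hom: "diagram_iso \<alpha> \<Longrightarrow> group_hom W W \<alpha>"
  by (simp add: diagram_iso_def iso_def group_hom_def group_hom_axioms_def group_axioms)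

lemma diagram_iso_coset:
  assumes "diagram_iso \<alpha>" "w \<in> carrier W" "T \<subseteq> S"
  shows "\<alpha> ` (w <# generate W T) = \<alpha> w <# generate W (\<alpha> ` T)"
proof -
  interpret \<alpha>: group_hom W W \<alpha> using assms by (intro diagram_iso_hom)
  have T: "T \<subseteq> carrier W" using assms S_carrier by blast
  have "\<alpha> (w \<otimes> h) = \<alpha> w \<otimes> \<alpha> h" if "h \<in> generate W T" for h
    using that assms generate_incl[OF T] by (intro \<alpha>.hom_mult) auto
  then show ?thesis
    unfolding \<alpha>.generate_img[OF T] by (simp add: l_coset_def image_UN)
qed

text \<open>Such a map carries $W_T$ bijectively onto the subgroup generated by the image of $T$, so
  spherical sets correspond to spherical sets.\<close>

lemma cellular_diagram_iso: assumes "diagram_iso \<alpha>" shows "cellular \<alpha>"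
proof -
  interpret \<alpha>: group_hom W W \<alpha> using assms by (intro diagram_iso_hom)
  have bij: "bij_betw \<alpha> (carrier W) (carrier W)" and S: "bij_betw \<alpha> S S"
    using assms by (auto simp: diagram_iso_def iso_def order_preserving_def)
  have spherical: "spherical W S (\<alpha> ` T) \<longleftrightarrow> spherical W S T" if T: "T \<subseteq> S" for T
  proof -
    have TW: "T \<subseteq> carrier W" using T S_carrier by blast
    have "inj_on \<alpha> (generate W T)"
      using bij generate_incl[OF TW] inj_on_subset unfolding bij_betw_def by blast
    moreover have "\<alpha> ` T \<subseteq> S" using T bij_betwE[OF S] by blast
    ultimately show ?thesis
      using T \<alpha>.generate_img[OF TW] by (simp add: spherical_def finite_image_iff)
  qed
  have "(\<lambda>A. \<alpha> ` A) ` cells \<subseteq> cells"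
  proof clarify
    fix A assume "A \<in> cells"
    then obtain w T where wT: "A = w <# generate W T" "w \<in> carrier W" "spherical W S T"
      by (auto simp: davis_cells_def)
    then show "\<alpha> ` A \<in> cells"
      using diagram_iso_coset[OF assms] spherical cellI by (auto simp: spherical_def)
  qed
  moreover have "cells \<subseteq> (\<lambda>A. \<alpha> ` A) ` cells"
  proof
    fix A assume "A \<in> cells"
    then obtain w T where wT: "A = w <# generate W T" "w \<in> carrier W" "spherical W S T"
      by (auto simp: davis_cells_def)
    obtain w' where w': "w' \<in> carrier W" "w = \<alpha> w'" using bij wT by (metis bij_betw_def imageE)
    obtain T' where T': "T' \<subseteq> S" "T = \<alpha> ` T'"
      using S wT by (metis bij_betw_def spherical_def subset_imageE)
    have "A = \<alpha> ` (w' <# generate W T')" using diagram_iso_coset[OF assms] w' T' wT by simp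
    moreover have "w' <# generate W T' \<in> cells" using wT w' T' spherical cellI by blast
    ultimately show "A \<in> (\<lambda>A. \<alpha> ` A) ` cells" by blast
  qed
  ultimately show ?thesis using bij by (simp add: cellular_def)
qed

lemma hom_eqI:
  assumes "group_hom W W \<alpha>" "group_hom W W \<beta>" "\<And>s. s \<in> S \<Longrightarrow> \<alpha> s = \<beta> s" "x \<in> carrier W"
  shows "\<alpha> x = \<beta> x"
proof -
  interpret \<alpha>: group_hom W W \<alpha> by fact
  interpret \<beta>: group_hom W W \<beta> by fact
  obtain u where u: "u \<in> lists S" "wprod u = x" using word_exists assms by blast
  have "\<alpha> (wprod u) = \<beta> (wprod u)"
    using u(1) by induction (simp_all add: lists_S_closed assms)
  then show ?thesis using u by simp
qed

lemma diagram_iso_id: "diagram_iso (\<lambda>x. x)"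
  by (auto simp: diagram_iso_def order_preserving_def iso_def hom_def bij_betw_def)

lemma order_preserving_comp:
  assumes "order_preserving \<phi>" "order_preserving \<psi>" shows "order_preserving (\<phi> \<circ> \<psi>)"
proof -
  have bij: "bij_betw \<psi> S S" "bij_betw (\<phi> \<circ> \<psi>) S S"
    using assms bij_betw_trans by (auto simp: order_preserving_def)
  then have "\<psi> s \<in> S" "\<psi> s = \<psi> t \<longleftrightarrow> s = t" if "s \<in> S" "t \<in> S" for s t
    using that by (auto simp: bij_betw_def inj_on_eq_iff)
  then show ?thesis using assms bij by (simp add: order_preserving_def)
qed

lemma order_preserving_inv:
  assumes "order_preserving \<phi>" shows "order_preserving (inv_into S \<phi>)"
proof -
  have bij: "bij_betw \<phi> S S" using assms by (simp add: order_preserving_def)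
  have "ord (inv_into S \<phi> s \<otimes> inv_into S \<phi> t) = ord (s \<otimes> t)" if "s \<in> S" "t \<in> S" "s \<noteq> t" for s t
    using assms bij_betwE[OF bij_betw_inv_into[OF bij]] bij_betw_inv_into_right[OF bij] that
    unfolding order_preserving_def by metis
  then show ?thesis using bij_betw_inv_into[OF bij] by (simp add: order_preserving_def)
qed

lemma diagram_iso_comp:
  assumes "diagram_iso \<alpha>" "diagram_iso \<beta>" shows "diagram_iso (\<alpha> \<circ> \<beta>)"
  using assms order_preserving_comp iso_set_trans[of \<beta> W W \<alpha> W]
  by (simp add: diagram_iso_def compose_def)

lemma diagram_iso_inv:
  assumes "diagram_iso \<alpha>" shows "diagram_iso (inv_into (carrier W) \<alpha>)"
proof -
  have bij: "bij_betw \<alpha> (carrier W) (carrier W)" and S: "bij_betw \<alpha> S S"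
    using assms by (auto simp: diagram_iso_def iso_def order_preserving_def)
  \<comment> \<open>The inverse on $W$ must restrict to the inverse permutation of $S$ before order
    preservation can be transferred.\<close>
  have eq: "inv_into (carrier W) \<alpha> s = inv_into S \<alpha> s" if "s \<in> S" for s
  proof (rule inv_into_f_eq)
    show "inj_on \<alpha> (carrier W)" using bij by (simp add: bij_betw_def)
    have "inv_into S \<alpha> s \<in> S" using that S by (metis bij_betwE bij_betw_inv_into)
    then show "inv_into S \<alpha> s \<in> carrier W" by simp
    show "\<alpha> (inv_into S \<alpha> s) = s" using that S by (rule bij_betw_inv_into_right[rotated])
  qed
  have "order_preserving (inv_into (carrier W) \<alpha>)"
    using order_preserving_inv[of \<alpha>] assms eq unfolding diagram_iso_def order_preserving_def
    by (simp cong: bij_betw_cong)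
  then show ?thesis using assms iso_set_sym[of \<alpha> W] by (simp add: diagram_iso_def)
qed

section \<open>The two subgroups and their product\<close>

lemma left_mult_auts_subgroup: "subgroup (left_mult_auts W S) Aut"
proof -
  interpret A: group Aut by (rule Aut_group)
  have mult: "induced_map W S (\<lambda>x. v \<otimes> x) \<otimes>\<^bsub>Aut\<^esub> induced_map W S (\<lambda>x. w \<otimes> x) =
      induced_map W S (\<lambda>x. v \<otimes> w \<otimes> x)" if "v \<in> carrier W" "w \<in> carrier W" for v w
    using that by (auto simp: induced_map_mult cellular_left_mult m_assoc intro!: induced_map_cong)
  show ?thesis
  proof (rule A.subgroupI)
    show "left_mult_auts W S \<subseteq> carrier Aut"
      by (auto simp: left_mult_auts_def cellular_left_mult induced_map_in_Aut)
    show "left_mult_auts W S \<noteq> {}" by (auto simp: left_mult_auts_def)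
  next
    fix f assume "f \<in> left_mult_auts W S"
    then obtain w where w: "w \<in> carrier W" "f = induced_map W S (\<lambda>x. w \<otimes> x)"
      by (auto simp: left_mult_auts_def)
    have "induced_map W S (\<lambda>x. inv w \<otimes> x) \<otimes>\<^bsub>Aut\<^esub> f = \<one>\<^bsub>Aut\<^esub>"
      using w mult[of "inv w" w] by (simp add: induced_map_one induced_map_eq_iff)
    then have "inv\<^bsub>Aut\<^esub> f = induced_map W S (\<lambda>x. inv w \<otimes> x)"
      using w by (intro A.inv_equality) (auto simp: cellular_left_mult induced_map_in_Aut)
    then show "inv\<^bsub>Aut\<^esub> f \<in> left_mult_auts W S" using w by (auto simp: left_mult_auts_def)
  next
    fix f g assume "f \<in> left_mult_auts W S" "g \<in> left_mult_auts W S"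
    then show "f \<otimes>\<^bsub>Aut\<^esub> g \<in> left_mult_auts W S"
      using mult by (auto simp: left_mult_auts_def)
  qed
qed

lemma diagram_auts_subgroup: "subgroup (diagram_auts W S) Aut"
proof -
  interpret A: group Aut by (rule Aut_group)
  show ?thesis
  proof (rule A.subgroupI)
    show "diagram_auts W S \<subseteq> carrier Aut"
      by (auto simp: diagram_auts_eq cellular_diagram_iso induced_map_in_Aut)
    show "diagram_auts W S \<noteq> {}" using diagram_iso_id by (auto simp: diagram_auts_eq)
  next
    fix f assume "f \<in> diagram_auts W S"
    then obtain \<alpha> where \<alpha>: "diagram_iso \<alpha>" "f = induced_map W S \<alpha>"
      by (auto simp: diagram_auts_eq)
    let ?\<beta> = "inv_into (carrier W) \<alpha>"
    note \<beta> = diagram_iso_inv[OF \<alpha>(1)] and cell = cellular_diagram_iso[OF \<alpha>(1)]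
    have "induced_map W S ?\<beta> \<otimes>\<^bsub>Aut\<^esub> f = \<one>\<^bsub>Aut\<^esub>"
      using \<alpha> \<beta> by (simp add: induced_map_mult cellular_diagram_iso induced_map_one
          induced_map_eq_iff cellular_inv_cancel[OF cell])
    then have "inv\<^bsub>Aut\<^esub> f = induced_map W S ?\<beta>"
      using \<alpha> \<beta> by (intro A.inv_equality) (auto simp: cellular_diagram_iso induced_map_in_Aut)
    then show "inv\<^bsub>Aut\<^esub> f \<in> diagram_auts W S" using \<beta> by (auto simp: diagram_auts_eq)
  next
    fix f g assume "f \<in> diagram_auts W S" "g \<in> diagram_auts W S"
    then show "f \<otimes>\<^bsub>Aut\<^esub> g \<in> diagram_auts W S"
      using diagram_iso_comp
      by (auto simp: diagram_auts_eq induced_map_mult cellular_diagram_iso)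
  qed
qed

text \<open>Diagram automorphisms normalise the left multiplications, which is the source of
  normality in the semidirect product.\<close>

lemma diagram_iso_left_mult:
  assumes "diagram_iso \<alpha>" "w \<in> carrier W"
  shows "induced_map W S \<alpha> \<otimes>\<^bsub>Aut\<^esub> induced_map W S (\<lambda>x. w \<otimes> x) =
    induced_map W S (\<lambda>x. \<alpha> w \<otimes> x) \<otimes>\<^bsub>Aut\<^esub> induced_map W S \<alpha>"
proof -
  interpret \<alpha>: group_hom W W \<alpha> using assms by (intro diagram_iso_hom)
  show ?thesis using assms
    by (auto simp: induced_map_mult cellular_diagram_iso cellular_left_mult intro!: induced_map_cong)
qed

text \<open>The product condition is the whole content. Normality follows from it by
  \<open>diagram_iso_left_mult\<close>, and the intersection is trivial because a diagram
  automorphism fixes the vertex of the identity, which left multiplication by $w$ sends to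
  $w$.\<close>

lemma semidirect_iff:
  "internal_semidirect_product Aut (left_mult_auts W S) (diagram_auts W S) \<longleftrightarrow>
   (\<forall>f\<in>carrier Aut. \<exists>l\<in>left_mult_auts W S. \<exists>d\<in>diagram_auts W S. f = l \<otimes>\<^bsub>Aut\<^esub> d)"
    (is "?semi \<longleftrightarrow> ?all")
proof
  assume ?semi
  then show ?all unfolding internal_semidirect_product_def set_mult_def by blast
next
  assume all: ?all
  interpret A: group Aut by (rule Aut_group)
  interpret L: subgroup "left_mult_auts W S" Aut by (rule left_mult_auts_subgroup)
  interpret D: subgroup "diagram_auts W S" Aut by (rule diagram_auts_subgroup)
  have conj: "d \<otimes>\<^bsub>Aut\<^esub> h \<otimes>\<^bsub>Aut\<^esub> inv\<^bsub>Aut\<^esub> d \<in> left_mult_auts W S"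
    if d: "d \<in> diagram_auts W S" and h: "h \<in> left_mult_auts W S" for d h
  proof -
    obtain \<alpha> w where aw: "diagram_iso \<alpha>" "d = induced_map W S \<alpha>"
      "w \<in> carrier W" "h = induced_map W S (\<lambda>x. w \<otimes> x)"
      using d h by (auto simp: diagram_auts_eq left_mult_auts_def)
    let ?h = "induced_map W S (\<lambda>x. \<alpha> w \<otimes> x)"
    have h': "?h \<in> left_mult_auts W S"
      using aw cellular_closed cellular_diagram_iso by (auto simp: left_mult_auts_def)
    have "d \<otimes>\<^bsub>Aut\<^esub> h = ?h \<otimes>\<^bsub>Aut\<^esub> d" using diagram_iso_left_mult aw by simp
    then have "d \<otimes>\<^bsub>Aut\<^esub> h \<otimes>\<^bsub>Aut\<^esub> inv\<^bsub>Aut\<^esub> d = ?h" using d h' by (simp add: A.m_assoc)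
    then show ?thesis using h' by simp
  qed
  have "left_mult_auts W S \<lhd> Aut"
  proof (rule A.normal_invI[OF left_mult_auts_subgroup])
    fix f h assume f: "f \<in> carrier Aut" and h: "h \<in> left_mult_auts W S"
    obtain l d where ld: "l \<in> left_mult_auts W S" "d \<in> diagram_auts W S" "f = l \<otimes>\<^bsub>Aut\<^esub> d"
      using all f by blast
    have "f \<otimes>\<^bsub>Aut\<^esub> h \<otimes>\<^bsub>Aut\<^esub> inv\<^bsub>Aut\<^esub> f =
        l \<otimes>\<^bsub>Aut\<^esub> (d \<otimes>\<^bsub>Aut\<^esub> h \<otimes>\<^bsub>Aut\<^esub> inv\<^bsub>Aut\<^esub> d) \<otimes>\<^bsub>Aut\<^esub> inv\<^bsub>Aut\<^esub> l"
      using ld h by (simp add: A.m_assoc A.inv_mult_group)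
    then show "f \<otimes>\<^bsub>Aut\<^esub> h \<otimes>\<^bsub>Aut\<^esub> inv\<^bsub>Aut\<^esub> f \<in> left_mult_auts W S"
      using conj[OF ld(2) h] ld by simp
  qed
  moreover have "left_mult_auts W S \<inter> diagram_auts W S \<subseteq> {\<one>\<^bsub>Aut\<^esub>}"
  proof clarify
    fix f assume f: "f \<in> left_mult_auts W S" "f \<in> diagram_auts W S"
    obtain \<alpha> w where aw: "diagram_iso \<alpha>" "f = induced_map W S \<alpha>"
      "w \<in> carrier W" "f = induced_map W S (\<lambda>x. w \<otimes> x)"
      using f by (auto simp: diagram_auts_eq left_mult_auts_def)
    interpret \<alpha>: group_hom W W \<alpha> using aw by (intro diagram_iso_hom)
    have "\<alpha> \<one> = w \<otimes> \<one>" using aw induced_map_eq_iff by (metis one_closed)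
    then have "w = \<one>" using aw by simp
    then show "f = \<one>\<^bsub>Aut\<^esub>" using aw by (simp add: induced_map_one induced_map_eq_iff)
  qed
  ultimately show ?semi
    unfolding internal_semidirect_product_def set_mult_def
    using all L.one_closed D.one_closed diagram_auts_subgroup by auto
qed

section \<open>Discreteness of the automorphism group\<close>

text \<open>Discreteness means that the identity is isolated: neighbourhoods elsewhere are left
  translates of those at the identity.\<close>

lemma discrete_iff:
  "davis_Aut_topology W S = discrete_topology (carrier Aut) \<longleftrightarrow>
   (\<exists>F. finite F \<and> F \<subseteq> cells \<and> pointwise_stabiliser W S F \<subseteq> {\<one>\<^bsub>Aut\<^esub>})"
proof
  interpret A: group Aut by (rule Aut_group)
  assume "davis_Aut_topology W S = discrete_topology (carrier Aut)"
  then have "openin (davis_Aut_topology W S) {\<one>\<^bsub>Aut\<^esub>}" by simp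
  then obtain F where F: "finite F" "F \<subseteq> cells"
    and one: "\<one>\<^bsub>Aut\<^esub> <#\<^bsub>Aut\<^esub> pointwise_stabiliser W S F \<subseteq> {\<one>\<^bsub>Aut\<^esub>}"
    by (auto simp: openin_davis_Aut_topology)
  have "pointwise_stabiliser W S F \<subseteq> carrier Aut" by (auto simp: pointwise_stabiliser_def)
  then show "\<exists>F. finite F \<and> F \<subseteq> cells \<and> pointwise_stabiliser W S F \<subseteq> {\<one>\<^bsub>Aut\<^esub>}"
    using F one by (auto simp: A.lcos_mult_one)
next
  interpret A: group Aut by (rule Aut_group)
  assume "\<exists>F. finite F \<and> F \<subseteq> cells \<and> pointwise_stabiliser W S F \<subseteq> {\<one>\<^bsub>Aut\<^esub>}"
  then obtain F where F: "finite F" "F \<subseteq> cells" "pointwise_stabiliser W S F \<subseteq> {\<one>\<^bsub>Aut\<^esub>}" by blast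
  have "openin (davis_Aut_topology W S) U \<longleftrightarrow> U \<subseteq> carrier Aut" for U
  proof
    assume U: "U \<subseteq> carrier Aut"
    have "f <#\<^bsub>Aut\<^esub> pointwise_stabiliser W S F \<subseteq> U" if "f \<in> U" for f
    proof -
      have "f \<otimes>\<^bsub>Aut\<^esub> \<one>\<^bsub>Aut\<^esub> = f" using that U by auto
      then show ?thesis using that F(3) unfolding l_coset_def by fastforce
    qed
    then show "openin (davis_Aut_topology W S) U"
      using U F by (auto simp: openin_davis_Aut_topology)
  qed (simp add: openin_davis_Aut_topology)
  then show "davis_Aut_topology W S = discrete_topology (carrier Aut)"
    by (simp add: topology_eq)
qed

text \<open>If the product of left multiplication by $w$ and $\<alpha>$ fixes the vertex of the
  identity, then $w$ is trivial; if it also fixes all generators, then so does $\<alpha>$, which is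
  then the identity on $W$. Finiteness of $S$ makes this a finite set of cells.\<close>

lemma discrete_if_decomposable:
  assumes "finite S"
    and all: "\<forall>f\<in>carrier Aut. \<exists>l\<in>left_mult_auts W S. \<exists>d\<in>diagram_auts W S. f = l \<otimes>\<^bsub>Aut\<^esub> d"
  shows "davis_Aut_topology W S = discrete_topology (carrier Aut)"
proof -
  let ?F = "(\<lambda>x. {x}) ` insert \<one> S"
  have "f = \<one>\<^bsub>Aut\<^esub>" if f: "f \<in> pointwise_stabiliser W S ?F" for f
  proof -
    obtain l d where "l \<in> left_mult_auts W S" "d \<in> diagram_auts W S" "f = l \<otimes>\<^bsub>Aut\<^esub> d"
      using f all by (auto simp: pointwise_stabiliser_def)
    then obtain w \<alpha> where aw: "diagram_iso \<alpha>" "w \<in> carrier W"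
        "f = induced_map W S (\<lambda>x. w \<otimes> x) \<otimes>\<^bsub>Aut\<^esub> induced_map W S \<alpha>"
      by (auto simp: diagram_auts_eq left_mult_auts_def)
    interpret \<alpha>: group_hom W W \<alpha> using aw by (intro diagram_iso_hom)
    have f_eq: "f = induced_map W S (\<lambda>x. w \<otimes> \<alpha> x)"
      using aw by (simp add: induced_map_mult cellular_diagram_iso cellular_left_mult o_def)
    have fix_f: "w \<otimes> \<alpha> x = x" if "x \<in> insert \<one> S" for x
    proof -
      have "f {x} = {x}" using f that by (auto simp: pointwise_stabiliser_def)
      moreover have "f {x} = {w \<otimes> \<alpha> x}"
        unfolding f_eq using that by (intro induced_map_vertex) auto
      ultimately show ?thesis by (metis singleton_inject)
    qed
    have w: "w = \<one>" using fix_f[of \<one>] aw by simp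
    have fix_S: "\<alpha> s = s" if "s \<in> S" for s using fix_f[of s] w that by simp
    have "\<alpha> x = x" if "x \<in> carrier W" for x
      using hom_eqI[OF \<alpha>.group_hom_axioms diagram_iso_hom[OF diagram_iso_id] fix_S that] .
    then show ?thesis using f_eq w by (simp add: induced_map_one induced_map_eq_iff)
  qed
  then have "pointwise_stabiliser W S ?F \<subseteq> {\<one>\<^bsub>Aut\<^esub>}" by (intro subsetI) (simp only: singleton_iff)
  moreover have "?F \<subseteq> cells" using vertex_cell by auto
  moreover have "finite ?F" using assms(1) by simp
  ultimately show ?thesis unfolding discrete_iff by (intro exI[of _ ?F] conjI)
qed

end

section \<open>Rigidity for diagrams that are not flexible\<close>

context coxeter_group begin

section \<open>Local permutations of the generators\<close>

definition local_perm :: "('a \<Rightarrow> 'a) \<Rightarrow> 'a \<Rightarrow> 'a \<Rightarrow> 'a" where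
  "local_perm h w s = inv (h w) \<otimes> h (w \<otimes> s)"

lemma local_perm_eq:
  assumes "cellular h" "w \<in> carrier W" "s \<in> S"
  shows "h (w \<otimes> s) = h w \<otimes> local_perm h w s"
  using assms by (simp add: local_perm_def cellular_closed flip: m_assoc)

lemma local_perm_eqI:
  assumes "cellular h" "w \<in> carrier W" "s \<in> S" "r \<in> carrier W" "h (w \<otimes> s) = h w \<otimes> r"
  shows "local_perm h w s = r"
  using assms by (simp add: local_perm_def cellular_closed flip: m_assoc)

lemma generate_single: assumes "s \<in> S" shows "generate W {s} = {\<one>, s}"
proof
  show "generate W {s} \<subseteq> {\<one>, s}"
  proof
    fix x assume "x \<in> generate W {s}" then show "x \<in> {\<one>, s}"
      by induction (use assms in auto)
  qed
qed (auto intro: generate.intros)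

text \<open>The edge cell with elements $w$ and $ws$ goes to a two-element coset of some $W_T$
  containing $h(w)$. Any $t$ in $T$ then produces its second element.\<close>

lemma local_perm_closed:
  assumes h: "cellular h" and w: "w \<in> carrier W" and s: "s \<in> S"
  shows "local_perm h w s \<in> S"
proof -
  let ?A = "w <# generate W {s}"
  have A: "?A = {w, w \<otimes> s}" using w s by (auto simp: generate_single l_coset_def)
  have "?A \<in> cells" using w s by (intro cellI) (auto simp: spherical_def generate_single)
  then have cell: "h ` ?A \<in> cells" using h by (rule cellular_image[rotated])
  have hA: "h ` ?A = {h w, h (w \<otimes> s)}" by (simp add: A)
  have "w \<otimes> s \<noteq> w" using w s S_nontrivial by simp
  then have neq: "h (w \<otimes> s) \<noteq> h w" using h w s by (simp add: cellular_eq_iff)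
  obtain T where T: "spherical W S T" "h ` ?A = h w <# generate W T" "h w \<in> carrier W"
    using cell_at[OF cell, of "h w"] hA by auto
  have "T \<noteq> {}"
  proof
    assume "T = {}"
    then have "h ` ?A = {h w}" using T by (simp add: generate_empty l_coset_def)
    then show False using hA neq by auto
  qed
  then obtain t where t: "t \<in> T" "t \<in> S" using T by (auto simp: spherical_def)
  have "h w \<otimes> t \<in> h ` ?A" unfolding T(2) using t by (auto simp: l_coset_def intro: generate.incl)
  moreover have "h w \<otimes> t \<noteq> h w" using t T(3) S_nontrivial by simp
  ultimately have "h (w \<otimes> s) = h w \<otimes> t" using hA by auto
  then show ?thesis using local_perm_eqI[OF h w s, of t] t by simp
qed

lemma local_perm_inv:
  assumes h: "cellular h" and w: "w \<in> carrier W" and s: "s \<in> S"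
  shows "local_perm (inv_into (carrier W) h) (h w) (local_perm h w s) = s"
proof (rule local_perm_eqI)
  show "inv_into (carrier W) h (h w \<otimes> local_perm h w s) = inv_into (carrier W) h (h w) \<otimes> s"
    using assms by (simp add: cellular_inv_cancel flip: local_perm_eq)
qed (use assms in \<open>auto simp: cellular_inv cellular_closed local_perm_closed\<close>)

lemma local_perm_inv':
  assumes h: "cellular h" and w: "w \<in> carrier W" and s: "s \<in> S"
  shows "local_perm h w (local_perm (inv_into (carrier W) h) (h w) s) = s"
proof (rule local_perm_eqI[OF h w])
  let ?g = "inv_into (carrier W) h"
  have g: "cellular ?g" using h by (rule cellular_inv)
  show S: "local_perm ?g (h w) s \<in> S" using assms g by (simp add: local_perm_closed cellular_closed)
  have "?g (h w \<otimes> s) = w \<otimes> local_perm ?g (h w) s"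
    using local_perm_eq[OF g, of "h w" s] assms by (simp add: cellular_closed cellular_inv_cancel)
  then have "h (w \<otimes> local_perm ?g (h w) s) = h (?g (h w \<otimes> s))" by simp
  also have "\<dots> = h w \<otimes> s" using assms by (intro cellular_inv_cancel) (auto simp: cellular_closed)
  finally show "h (w \<otimes> local_perm ?g (h w) s) = h w \<otimes> s" .
qed (use s in simp)

lemma local_perm_bij:
  assumes h: "cellular h" and w: "w \<in> carrier W"
  shows "bij_betw (local_perm h w) S S"
  by (rule bij_betw_byWitness[where f' = "local_perm (inv_into (carrier W) h) (h w)"])
    (use assms in \<open>auto simp: local_perm_inv local_perm_inv' local_perm_closed cellular_inv cellular_closed\<close>)

lemma dihedral_cell:
  assumes "w \<in> carrier W" "s \<in> S" "t \<in> S" "ord (s \<otimes> t) \<noteq> 0"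
  shows "w <# generate W {s, t} \<in> cells"
  using assms dihedral_finite by (intro cellI) (auto simp: spherical_def)

text \<open>The type of a cell can be read off at any of its vertices, as the set of generators
  whose edges from that vertex stay in the cell; this uses \<open>parabolic_generators\<close> on
  both sides.\<close>

lemma image_dihedral_cell:
  assumes h: "cellular h" and w: "w \<in> carrier W" and st: "s \<in> S" "t \<in> S" "ord (s \<otimes> t) \<noteq> 0"
  shows "h ` (w <# generate W {s, t}) = h w <# generate W {local_perm h w s, local_perm h w t}"
proof -
  let ?A = "w <# generate W {s, t}"
  have sub: "subgroup (generate W {s, t}) W" using st by (intro generate_is_subgroup) auto
  have A: "?A \<in> cells" using w st by (rule dihedral_cell)
  have mem: "w \<otimes> r \<in> ?A \<longleftrightarrow> r \<in> {s, t}" if "r \<in> S" for r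
    using that w st sub parabolic_generators[of "{s, t}" r]
    by (auto simp: mult_mem_coset_iff intro: generate.incl)
  have "h w \<in> h ` ?A" using w sub by (auto simp: mem_coset_iff subgroup.one_closed)
  then obtain T where T: "spherical W S T" "h ` ?A = h w <# generate W T" "h w \<in> carrier W"
    using cell_at[OF cellular_image[OF h A]] by blast
  have TS: "T \<subseteq> S" using T by (simp add: spherical_def)
  have T_iff: "local_perm h w r \<in> T \<longleftrightarrow> r \<in> {s, t}" if r: "r \<in> S" for r
  proof -
    have S: "local_perm h w r \<in> S" using h w r by (rule local_perm_closed)
    have "local_perm h w r \<in> T \<longleftrightarrow> local_perm h w r \<in> generate W T"
      using parabolic_generators[OF TS S] generate.incl by auto
    also have "\<dots> \<longleftrightarrow> h w \<otimes> local_perm h w r \<in> h ` ?A"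
      unfolding T(2) using mult_mem_coset_iff[OF spherical_subgroup[OF T(1)] T(3)] S by simp
    also have "\<dots> \<longleftrightarrow> h (w \<otimes> r) \<in> h ` ?A" using h w r by (simp add: local_perm_eq)
    also have "\<dots> \<longleftrightarrow> w \<otimes> r \<in> ?A"
      using cellular_bij[OF h] cell_subset[OF A] w r
      by (intro inj_on_image_mem_iff) (auto simp: bij_betw_def)
    finally show ?thesis using mem[OF r] by simp
  qed
  have "T = local_perm h w ` {s, t}"
  proof
    show "local_perm h w ` {s, t} \<subseteq> T" using T_iff st by auto
    show "T \<subseteq> local_perm h w ` {s, t}"
    proof
      fix r assume r: "r \<in> T"
      then obtain q where q: "q \<in> S" "r = local_perm h w q"
        using local_perm_bij[OF h w] TS by (metis bij_betw_def imageE subsetD)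
      then show "r \<in> local_perm h w ` {s, t}" using T_iff[of q] r by blast
    qed
  qed
  then show ?thesis using T(2) by simp
qed

text \<open>The same edge is traversed backwards, and its image type is an involution.\<close>

lemma local_perm_same:
  assumes h: "cellular h" and w: "w \<in> carrier W" and s: "s \<in> S"
  shows "local_perm h (w \<otimes> s) s = local_perm h w s"
proof (rule local_perm_eqI[OF h])
  have "local_perm h w s \<in> S" using assms by (rule local_perm_closed)
  then show "h (w \<otimes> s \<otimes> s) = h (w \<otimes> s) \<otimes> local_perm h w s"
    using assms by (simp add: local_perm_eq m_assoc cellular_closed)
  show "local_perm h w s \<in> carrier W" using \<open>local_perm h w s \<in> S\<close> by simp
qed (use assms in auto)

text \<open>The image of $wst$ stays in the image of the dihedral cell, so the type $r$ of the
  second step is one of $p$, $q$. It is not $p$, which is already the image type of $s$ at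
  $ws$.\<close>

lemma local_perm_adjacent:
  assumes h: "cellular h" and w: "w \<in> carrier W" and st: "s \<in> S" "t \<in> S" "ord (s \<otimes> t) \<noteq> 0"
  shows "local_perm h (w \<otimes> s) t = local_perm h w t"
proof (cases "s = t")
  case True
  then show ?thesis using local_perm_same[OF h w] st by simp
next
  case False
  define p q r where "p = local_perm h w s" and "q = local_perm h w t"
    and "r = local_perm h (w \<otimes> s) t"
  have S: "p \<in> S" "q \<in> S" "r \<in> S"
    using assms by (auto simp: p_def q_def r_def local_perm_closed)
  have sub: "subgroup (generate W {s, t}) W" using st by (intro generate_is_subgroup) auto
  have sub': "subgroup (generate W {p, q}) W" using S by (intro generate_is_subgroup) auto
  have "w \<otimes> s \<in> w <# generate W {s, t}" using w st sub by (simp add: mult_mem_coset_iff generate.incl)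
  then have eq: "w <# generate W {s, t} = (w \<otimes> s) <# generate W {s, t}"
    using w sub by (rule l_repr_independence)
  have "h (w \<otimes> s \<otimes> t) \<in> h ` ((w \<otimes> s) <# generate W {s, t})"
    by (auto simp: l_coset_def intro: generate.incl)
  then have "h (w \<otimes> s \<otimes> t) \<in> h w <# generate W {p, q}"
    using image_dihedral_cell[OF h w st] eq by (simp add: p_def q_def)
  moreover have "h (w \<otimes> s \<otimes> t) = h w \<otimes> (p \<otimes> r)"
    using local_perm_eq[OF h, of "w \<otimes> s" t] local_perm_eq[OF h w st(1)] w st S h
    by (simp add: m_assoc cellular_closed flip: p_def r_def)
  ultimately have "p \<otimes> r \<in> generate W {p, q}"
    using sub' S h w by (simp add: mult_mem_coset_iff cellular_closed)
  moreover have "p \<in> generate W {p, q}" by (simp add: generate.incl)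
  ultimately have "p \<otimes> (p \<otimes> r) \<in> generate W {p, q}" by (rule generate.eng[rotated])
  then have "r \<in> generate W {p, q}" using S by simp
  then have "r \<in> {p, q}" using parabolic_generators[of "{p, q}" r] S by blast
  moreover have "r \<noteq> p"
  proof -
    have "p = local_perm h (w \<otimes> s) s" using local_perm_same[OF h w st(1)] by (simp add: p_def)
    then show ?thesis
      using local_perm_bij[OF h, of "w \<otimes> s"] w st False by (auto simp: r_def bij_betw_def inj_on_eq_iff)
  qed
  ultimately show ?thesis by (simp add: q_def r_def)
qed

text \<open>Around a dihedral cell the image types of $s$ and $t$ do not change, so $h(w (st)^k) =
  h(w)(pq)^k$. Injectivity of $h$ makes the two products return to the start at the same
  exponents.\<close>

lemma local_perm_order:
  assumes h: "cellular h" and w: "w \<in> carrier W" and st: "s \<in> S" "t \<in> S" "ord (s \<otimes> t) \<noteq> 0"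
  shows "ord (local_perm h w s \<otimes> local_perm h w t) = ord (s \<otimes> t)"
proof -
  define p q where "p = local_perm h w s" and "q = local_perm h w t"
  have S: "p \<in> S" "q \<in> S" using assms by (auto simp: p_def q_def local_perm_closed)
  have ts: "ord (t \<otimes> s) \<noteq> 0"
    using ord_inv[of "s \<otimes> t"] st by (simp add: inv_mult_group)
  have step: "h (w \<otimes> (s \<otimes> t) [^] k) = h w \<otimes> (p \<otimes> q) [^] k \<and>
      local_perm h (w \<otimes> (s \<otimes> t) [^] k) s = p \<and> local_perm h (w \<otimes> (s \<otimes> t) [^] k) t = q" for k :: nat
  proof (induction k)
    case 0
    then show ?case using w h by (simp add: p_def q_def cellular_closed)
  next
    case (Suc k)
    define x where "x = w \<otimes> (s \<otimes> t) [^] k"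
    have x: "x \<in> carrier W" using w st by (simp add: x_def)
    have next_x: "w \<otimes> (s \<otimes> t) [^] Suc k = x \<otimes> s \<otimes> t" using w st by (simp add: x_def m_assoc)
    have p: "local_perm h x s = p" and q: "local_perm h x t = q"
      and hx: "h x = h w \<otimes> (p \<otimes> q) [^] k" using Suc by (auto simp: x_def)
    have p1: "local_perm h (x \<otimes> s) s = p" and q1: "local_perm h (x \<otimes> s) t = q"
      using local_perm_same[OF h x] local_perm_adjacent[OF h x] st p q by auto
    have "local_perm h (x \<otimes> s \<otimes> t) s = p" "local_perm h (x \<otimes> s \<otimes> t) t = q"
      using local_perm_same[OF h, of "x \<otimes> s" t] local_perm_adjacent[OF h, of "x \<otimes> s" t s]
        ts st x p1 q1 by auto
    moreover have "h (x \<otimes> s \<otimes> t) = h x \<otimes> p \<otimes> q"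
      using local_perm_eq[OF h, of "x \<otimes> s" t] local_perm_eq[OF h x st(1)] x st p q1 by simp
    ultimately show ?case
      unfolding next_x using hx S h w by (simp add: m_assoc cellular_closed)
  qed
  have "(p \<otimes> q) [^] k = \<one> \<longleftrightarrow> (s \<otimes> t) [^] k = \<one>" for k :: nat
  proof -
    have "(p \<otimes> q) [^] k = \<one> \<longleftrightarrow> h w \<otimes> (p \<otimes> q) [^] k = h w"
      using S h w by (simp add: cellular_closed)
    also have "\<dots> \<longleftrightarrow> h (w \<otimes> (s \<otimes> t) [^] k) = h w" using step by simp
    also have "\<dots> \<longleftrightarrow> w \<otimes> (s \<otimes> t) [^] k = w" using h w st by (intro cellular_eq_iff) auto
    also have "\<dots> \<longleftrightarrow> (s \<otimes> t) [^] k = \<one>" using w st by simp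
    finally show ?thesis .
  qed
  then have "ord (p \<otimes> q) = ord (s \<otimes> t)"
    using S st by (simp add: ord_unique pow_eq_id)
  then show ?thesis by (simp add: p_def q_def)
qed

text \<open>For infinite order the dihedral argument is applied to the inverse map: were the image
  pair of finite order, the original pair would have that order as well.\<close>

lemma local_perm_order_preserving:
  assumes h: "cellular h" and w: "w \<in> carrier W"
  shows "order_preserving (local_perm h w)"
proof -
  let ?g = "inv_into (carrier W) h"
  have "ord (local_perm h w s \<otimes> local_perm h w t) = ord (s \<otimes> t)" if st: "s \<in> S" "t \<in> S" for s t
  proof (cases "ord (local_perm h w s \<otimes> local_perm h w t) = 0")
    case True
    then show ?thesis using local_perm_order[OF h w st] by auto
  next
    case False
    have "ord (local_perm ?g (h w) (local_perm h w s) \<otimes> local_perm ?g (h w) (local_perm h w t)) =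
        ord (local_perm h w s \<otimes> local_perm h w t)"
      using False st h w by (intro local_perm_order)
        (auto simp: cellular_inv cellular_closed local_perm_closed)
    then show ?thesis using st h w by (simp add: local_perm_inv)
  qed
  then show ?thesis using local_perm_bij[OF h w] by (simp add: order_preserving_def)
qed

text \<open>
  Across an edge of type $s$ the local permutations of the generators differ by a diagram
  automorphism that fixes $s$ and its neighbours.
\<close>

lemma local_perm_constant:
  assumes rigid: "\<not> flexible_diagram W S" and h: "cellular h"
    and w: "w \<in> carrier W" and t: "t \<in> S"
  shows "local_perm h w t = local_perm h \<one> t"
proof -
  have step: "local_perm h (x \<otimes> s) t = local_perm h x t"
    if x: "x \<in> carrier W" and s: "s \<in> S" and t: "t \<in> S" for x s t
  proof -
    define \<psi> where "\<psi> = inv_into S (local_perm h x) \<circ> local_perm h (x \<otimes> s)"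
    have bij: "bij_betw (local_perm h x) S S" using h x by (rule local_perm_bij)
    have xs: "x \<otimes> s \<in> carrier W" using x s by simp
    have "order_preserving \<psi>"
      unfolding \<psi>_def using h x xs
      by (intro order_preserving_comp order_preserving_inv local_perm_order_preserving)
    then have aut: "diagram_automorphism W S \<psi>" by (simp add: diagram_automorphism_iff)
    have fixed: "\<psi> r = r" if "r \<in> S" "local_perm h (x \<otimes> s) r = local_perm h x r" for r
      using that bij by (simp add: \<psi>_def bij_betw_inv_into_left)
    have "\<psi> s = s" using fixed local_perm_same[OF h x s] s by blast
    moreover have "\<psi> r = r" if "diagram_edge W S s r" for r
      using that fixed local_perm_adjacent[OF h x s] by (simp add: diagram_edge_iff)
    ultimately have "\<psi> t = t" using rigid aut s t unfolding flexible_diagram_def by blast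
    then have "local_perm h x (\<psi> t) = local_perm h x t" by simp
    moreover have "local_perm h x (\<psi> t) = local_perm h (x \<otimes> s) t"
      using bij_betw_inv_into_right[OF bij] local_perm_closed[OF h xs t] by (simp add: \<psi>_def)
    ultimately show ?thesis by simp
  qed
  have "local_perm h (wprod u) t = local_perm h \<one> t" if "u \<in> lists S" for u
    using that
  proof (induction u rule: rev_induct)
    case (snoc s u)
    then have "wprod (u @ [s]) = wprod u \<otimes> s" "wprod u \<in> carrier W" "s \<in> S"
      using lists_S_closed by auto
    then show ?case using step t snoc by simp
  qed simp
  then show ?thesis using word_exists[OF w] by metis
qed

lemma decomposable_if_not_flexible:
  assumes rigid: "\<not> flexible_diagram W S" and f: "f \<in> carrier Aut"
  shows "\<exists>l\<in>left_mult_auts W S. \<exists>d\<in>diagram_auts W S. f = l \<otimes>\<^bsub>Aut\<^esub> d"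
proof -
  obtain h where h: "cellular h" and f_eq: "f = induced_map W S h" using Aut_induced[OF f] .
  \<comment> \<open>Normalised to fix the identity. Since the local permutation is the same at every
    vertex, right multiplication by a generator commutes with \<open>\<alpha>\<close> up to that
    permutation, and induction on words gives a homomorphism.\<close>
  define \<alpha> where "\<alpha> x = inv (h \<one>) \<otimes> h x" for x
  have h1: "h \<one> \<in> carrier W" using h by (simp add: cellular_closed)
  have \<alpha>W: "\<alpha> x \<in> carrier W" if "x \<in> carrier W" for x
    using that h by (simp add: \<alpha>_def cellular_closed)
  have h_eq: "h x = h \<one> \<otimes> \<alpha> x" if "x \<in> carrier W" for x
    using that h by (simp add: \<alpha>_def cellular_closed flip: m_assoc)
  have \<alpha>S: "\<alpha> s = local_perm h \<one> s" if "s \<in> S" for s using that by (simp add: \<alpha>_def local_perm_def)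
  have \<alpha>1: "\<alpha> \<one> = \<one>" using h1 by (simp add: \<alpha>_def)
  have step: "\<alpha> (x \<otimes> s) = \<alpha> x \<otimes> \<alpha> s" if "x \<in> carrier W" "s \<in> S" for x s
  proof -
    have "h (x \<otimes> s) = h x \<otimes> local_perm h \<one> s"
      using local_perm_eq[OF h that] local_perm_constant[OF rigid h that] by simp
    then show ?thesis
      using that h h1 \<alpha>S \<alpha>W[of s] by (simp add: \<alpha>_def[of x] \<alpha>_def[of "x \<otimes> s"] cellular_closed m_assoc)
  qed
  have "\<alpha> (x \<otimes> wprod u) = \<alpha> x \<otimes> \<alpha> (wprod u)" if "u \<in> lists S" and x: "x \<in> carrier W" for x u
    using that(1)
  proof (induction u rule: rev_induct)
    case Nil
    then show ?case using x \<alpha>1 \<alpha>W by simp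
  next
    case (snoc s u)
    then have u: "wprod (u @ [s]) = wprod u \<otimes> s" "wprod u \<in> carrier W" "s \<in> S"
      using lists_S_closed by auto
    have "\<alpha> (x \<otimes> (wprod u \<otimes> s)) = \<alpha> (x \<otimes> wprod u) \<otimes> \<alpha> s"
      using u x step[of "x \<otimes> wprod u" s] by (simp add: m_assoc)
    also have "\<dots> = \<alpha> x \<otimes> (\<alpha> (wprod u) \<otimes> \<alpha> s)"
      using snoc u x \<alpha>W by (simp add: m_assoc)
    also have "\<alpha> (wprod u) \<otimes> \<alpha> s = \<alpha> (wprod u \<otimes> s)" using u step by simp
    finally show ?case by (simp only: u(1))
  qed
  then have mult: "\<alpha> (x \<otimes> y) = \<alpha> x \<otimes> \<alpha> y" if "x \<in> carrier W" "y \<in> carrier W" for x y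
    using that word_exists[of y] by metis
  have \<alpha>_comp: "cellular ((\<lambda>x. inv (h \<one>) \<otimes> x) \<circ> h)"
    using h h1 by (intro cellular_comp cellular_left_mult) auto
  have "\<alpha> = (\<lambda>x. inv (h \<one>) \<otimes> x) \<circ> h" by (auto simp: \<alpha>_def)
  then have \<alpha>_cell: "cellular \<alpha>" using \<alpha>_comp by simp
  have "\<alpha> \<in> iso W W"
    using cellular_bij[OF \<alpha>_cell] mult \<alpha>W by (auto simp: iso_def hom_def)
  moreover have "order_preserving \<alpha>"
    using local_perm_order_preserving[OF h one_closed] \<alpha>S
    by (simp add: order_preserving_def cong: bij_betw_cong)
  ultimately have "diagram_iso \<alpha>" by (simp add: diagram_iso_def)
  then have "induced_map W S \<alpha> \<in> diagram_auts W S" by (auto simp: diagram_auts_eq)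
  moreover have "induced_map W S (\<lambda>x. h \<one> \<otimes> x) \<in> left_mult_auts W S"
    using h1 by (auto simp: left_mult_auts_def)
  moreover have "f = induced_map W S ((\<lambda>x. h \<one> \<otimes> x) \<circ> \<alpha>)"
    unfolding f_eq o_def by (rule induced_map_cong[OF h_eq])
  then have "f = induced_map W S (\<lambda>x. h \<one> \<otimes> x) \<otimes>\<^bsub>Aut\<^esub> induced_map W S \<alpha>"
    using h1 \<alpha>_cell by (simp add: induced_map_mult cellular_left_mult)
  ultimately show ?thesis by blast
qed

end

section \<open>Nondiscreteness for flexible diagrams\<close>

context coxeter_group begin

section \<open>Extending diagram automorphisms to the group\<close>

lemma order_preserving_word_cong:
  assumes \<phi>: "order_preserving \<phi>" and uv: "wprod u = wprod v" "u \<in> lists S" "v \<in> lists S"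
  shows "wprod (map \<phi> u) = wprod (map \<phi> v)"
proof (rule word_invariant[where g = "\<lambda>u. wprod (map \<phi> u)", OF uv])
  have \<phi>S: "\<phi> s \<in> S" if "s \<in> S" for s
    using \<phi> that bij_betwE by (auto simp: order_preserving_def)
  have closed: "map \<phi> x \<in> lists (carrier W)" if "x \<in> lists S" for x
    using that \<phi>S S_closed by (auto simp: in_lists_conv_set)
  fix s x y assume "s \<in> S" and xy: "x \<in> lists S" "y \<in> lists S"
  then show "wprod (map \<phi> (x @ [s, s] @ y)) = wprod (map \<phi> (x @ y))"
    using closed \<phi>S by simp
  fix t assume "t \<in> S" "s \<noteq> t"
  then have ord: "ord (\<phi> s \<otimes> \<phi> t) = ord (s \<otimes> t)"
    using \<phi> \<open>s \<in> S\<close> by (simp add: order_preserving_def)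
  have "wprod (map \<phi> (alt s t (2 * ord (s \<otimes> t)))) = \<one>"
    using \<phi>S \<open>s \<in> S\<close> \<open>t \<in> S\<close> by (simp add: map_alt wprod_alt_even flip: ord)
  then show "wprod (map \<phi> (x @ alt s t (2 * ord (s \<otimes> t)) @ y)) = wprod (map \<phi> (x @ y))"
    using closed[OF xy(1)] closed[OF xy(2)]
      closed[OF alt_in_lists[OF \<open>s \<in> S\<close> \<open>t \<in> S\<close>]] by simp
qed

text \<open>Letterwise substitution is well defined on $W$ by the preceding lemma; the inverse
  permutation, extended in the same way, undoes it.\<close>

lemma order_preserving_extends:
  assumes \<phi>: "order_preserving \<phi>"
  obtains \<alpha> where "diagram_iso \<alpha>" "\<And>s. s \<in> S \<Longrightarrow> \<alpha> s = \<phi> s"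
proof -
  have bij: "bij_betw \<phi> S S" using \<phi> by (simp add: order_preserving_def)
  have lists: "map \<phi> u \<in> lists S" if "u \<in> lists S" for u
    using that bij_betwE[OF bij] by (auto simp: in_lists_conv_set)
  define \<alpha> where "\<alpha> w = wprod (map \<phi> (SOME u. u \<in> lists S \<and> wprod u = w))" for w
  have \<alpha>: "\<alpha> (wprod u) = wprod (map \<phi> u)" if u: "u \<in> lists S" for u
  proof -
    let ?v = "SOME v. v \<in> lists S \<and> wprod v = wprod u"
    have "?v \<in> lists S \<and> wprod ?v = wprod u" by (rule someI[of _ u]) (use u in simp)
    then show ?thesis unfolding \<alpha>_def using u \<phi> by (intro order_preserving_word_cong) auto
  qed
  have \<alpha>S: "\<alpha> s = \<phi> s" if "s \<in> S" for s
    using \<alpha>[of "[s]"] that bij_betwE[OF bij] by simp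
  have "\<alpha> \<in> hom W W"
  proof (rule homI)
    fix x y assume xy: "x \<in> carrier W" "y \<in> carrier W"
    obtain u v where uv: "u \<in> lists S" "wprod u = x" "v \<in> lists S" "wprod v = y"
      using xy word_exists by metis
    then show "\<alpha> x \<in> carrier W" using \<alpha>[of u] lists lists_S_closed by simp
    have "\<alpha> (wprod (u @ v)) = wprod (map \<phi> u @ map \<phi> v)" using \<alpha>[of "u @ v"] uv by simp
    then show "\<alpha> (x \<otimes> y) = \<alpha> x \<otimes> \<alpha> y"
      using \<alpha>[of u] \<alpha>[of v] uv lists[of u] lists[of v] lists_S_closed by simp
  qed
  moreover have "inj_on \<alpha> (carrier W)"
  proof (rule inj_onI)
    fix x y assume xy: "x \<in> carrier W" "y \<in> carrier W" and eq: "\<alpha> x = \<alpha> y"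
    obtain u v where uv: "u \<in> lists S" "wprod u = x" "v \<in> lists S" "wprod v = y"
      using xy word_exists by metis
    have "wprod (map \<phi> u) = wprod (map \<phi> v)" using eq \<alpha> uv by metis
    then have "wprod (map (inv_into S \<phi>) (map \<phi> u)) = wprod (map (inv_into S \<phi>) (map \<phi> v))"
      using order_preserving_word_cong[OF order_preserving_inv[OF \<phi>] _ lists[OF uv(1)] lists[OF uv(3)]]
      by blast
    moreover have "map (inv_into S \<phi>) (map \<phi> z) = z" if "z \<in> lists S" for z
      using that bij by (induction z) (auto simp: bij_betw_inv_into_left)
    ultimately show "x = y" using uv by metis
  qed
  moreover have "carrier W \<subseteq> \<alpha> ` carrier W"
  proof
    fix y assume "y \<in> carrier W"
    then obtain v where v: "v \<in> lists S" "wprod v = y" by (rule word_exists)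
    let ?u = "map (inv_into S \<phi>) v"
    have u: "?u \<in> lists S"
      using v bij_betwE[OF bij_betw_inv_into[OF bij]] by (auto simp: in_lists_conv_set)
    have "map \<phi> ?u = v"
      using v(1) bij by (induction v) (auto simp: bij_betw_inv_into_right)
    then have "\<alpha> (wprod ?u) = y" using \<alpha>[OF u] v by simp
    then show "y \<in> \<alpha> ` carrier W" using u lists_S_closed wprod_closed by blast
  qed
  ultimately have "\<alpha> \<in> iso W W" by (auto simp: iso_def bij_betw_def hom_def)
  moreover have "order_preserving \<alpha>"
    using \<phi> \<alpha>S by (simp add: order_preserving_def cong: bij_betw_cong)
  ultimately show ?thesis using that \<alpha>S by (simp add: diagram_iso_def)
qed

lemma inversion_diagram_iso:
  assumes \<alpha>: "diagram_iso \<alpha>" and x: "x \<in> carrier W" and r: "r \<in> carrier W"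
  shows "inversion (\<alpha> x) (\<alpha> r) \<longleftrightarrow> inversion x r"
proof -
  interpret \<alpha>: group_hom W W \<alpha> using \<alpha> by (rule diagram_iso_hom)
  have \<alpha>S: "\<alpha> s \<in> S" if "s \<in> S" for s
    using \<alpha> that bij_betwE by (auto simp: diagram_iso_def order_preserving_def)
  note eq_iff = cellular_eq_iff[OF cellular_diagram_iso[OF \<alpha>]]
  obtain u where u: "u \<in> lists S" "wprod u = x" using x by (rule word_exists)
  have "odd_refl (map \<alpha> u) (\<alpha> r) \<longleftrightarrow> odd_refl u r" if "r \<in> carrier W" for r
    using u(1) that
  proof (induction arbitrary: r)
    case (Cons s u)
    then show ?case using eq_iff[of r s] Cons.IH[of "s \<otimes> r \<otimes> s"] \<alpha>S by simp
  qed simp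
  moreover have "\<alpha> (wprod u) = wprod (map \<alpha> u)"
    using u(1) by induction (simp_all add: lists_S_closed)
  moreover have "map \<alpha> u \<in> lists S" using u(1) \<alpha>S by (auto simp: in_lists_conv_set)
  ultimately show ?thesis
    using u r inversion_wprod[of u r] inversion_wprod[of "map \<alpha> u" "\<alpha> r"] by auto
qed

section \<open>Branches and their exits\<close>

definition link :: "'a \<Rightarrow> 'a set" where
  "link s = {t. diagram_edge W S s t}"

definition star :: "'a \<Rightarrow> 'a set" where
  "star s = insert s (link s)"

text \<open>
  Since $W$ is the amalgam of $W_{\mathrm{star}(s)}$ and $W_{S - s}$ over $W_{\mathrm{link}(s)}$, it acts
  on a tree, and its elements correspond to the edges up to right multiplication by
  $W_{\mathrm{link}(s)}$. The following set is one branch at the vertex $W_{\mathrm{star}(s)}$.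
\<close>

definition branch :: "'a \<Rightarrow> 'a set" where
  "branch s = {b \<otimes> x | b x. b \<in> generate W (link s) \<and> x \<in> carrier W \<and>
     (\<forall>q\<in>star s. \<not> inversion x q)}"

lemma branchI:
  "b \<in> generate W (link s) \<Longrightarrow> x \<in> carrier W \<Longrightarrow> (\<And>q. q \<in> star s \<Longrightarrow> \<not> inversion x q) \<Longrightarrow>
    b \<otimes> x \<in> branch s"
  unfolding branch_def by blast

lemma link_subset: "link s \<subseteq> S" and star_subset: "s \<in> S \<Longrightarrow> star s \<subseteq> S"
  and self_not_in_link: "s \<notin> link s"
  by (auto simp: link_def star_def diagram_edge_iff)

lemma link_closed: "b \<in> generate W (link s) \<Longrightarrow> b \<in> carrier W"
  using parabolic_closed link_subset by blast

lemma branch_closed: "w \<in> branch s \<Longrightarrow> w \<in> carrier W"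
  by (auto simp: branch_def link_closed)

lemma generate_link_subset_star: "generate W (link s) \<subseteq> generate W (star s)"
  by (rule mono_generate) (auto simp: star_def)

text \<open>The only exits from the branch are the edges of type $s$ at elements of $W_{link(s)}$.
  If $xt$ acquires a left descent $q$ in the star, then $xt = qx$. For $q$ in the link, this factor
  is absorbed into $b$; for $q = s$, the element $x$ has to be trivial.\<close>

lemma branch_step:
  assumes s: "s \<in> S" and w: "w \<in> branch s" and t: "t \<in> S"
  shows "w \<otimes> t \<in> branch s \<or> w \<in> generate W (link s) \<and> t = s"
proof -
  obtain b x where bx: "w = b \<otimes> x" "b \<in> generate W (link s)" "x \<in> carrier W"
    and min: "\<And>q. q \<in> star s \<Longrightarrow> \<not> inversion x q"
    using w by (auto simp: branch_def)
  have b: "b \<in> carrier W" using bx link_closed by blast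
  have wt: "w \<otimes> t = b \<otimes> (x \<otimes> t)" using bx b t by (simp add: m_assoc)
  show ?thesis
  proof (cases "\<forall>q\<in>star s. \<not> inversion (x \<otimes> t) q")
    case True
    then show ?thesis unfolding wt using bx t by (simp add: branchI)
  next
    case False
    then obtain q where q: "q \<in> star s" "inversion (x \<otimes> t) q" by blast
    have qS: "q \<in> S" using q star_subset s by blast
    \<comment> \<open>The one reflection crossed between $x$ and $xt$ must be $q$, as $q$ was not an
      inversion before.\<close>
    have qx: "q \<otimes> x = x \<otimes> t" using q min bx t qS by (simp add: inversion_mult_right)
    show ?thesis
    proof (cases "q = s")
      case False
      then have "q \<in> link s" using q by (simp add: star_def)
      then have "b \<otimes> q \<in> generate W (link s)" by (intro generate.eng[OF bx(2)] generate.incl)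
      moreover have "w \<otimes> t = b \<otimes> q \<otimes> x" using wt qx b bx qS by (simp add: m_assoc)
      ultimately show ?thesis using branchI min bx by simp
    next
      case True
      \<comment> \<open>Otherwise a left descent $p$ of $x$ remains one of $sx$, next to $s$. Two
        descents force $sp$ to have finite order, so $p$ lies in the link, where $x$ has no
        descent.\<close>
      have "x = \<one>"
      proof (rule ccontr)
        assume "x \<noteq> \<one>"
        then obtain p where p: "p \<in> S" "inversion x p"
          using parabolic_descent[of S x] bx generate_S by auto
        have "p \<noteq> s" using p min by (auto simp: star_def)
        have "inversion (s \<otimes> x) s"
          using inversion_mult_left[OF s] bx min[of s] by (simp add: star_def)
        moreover have "inversion (s \<otimes> x) p"
        proof -
          have "p \<otimes> x \<noteq> s \<otimes> x" using \<open>p \<noteq> s\<close> p s bx by simp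
          then show ?thesis using qx True p t bx inversion_mult_right[of x t p] by simp
        qed
        ultimately have "ord (s \<otimes> p) \<noteq> 0"
          using two_descents_finite_order[OF s p(1), of "s \<otimes> x"] s bx by simp
        then have "p \<in> link s" using p s \<open>p \<noteq> s\<close> by (auto simp: link_def diagram_edge_iff)
        then show False using p min by (simp add: star_def)
      qed
      then have "w \<in> generate W (link s)" using bx b by simp
      moreover have "t = s" using qx True \<open>x = \<one>\<close> s t by simp
      ultimately show ?thesis by blast
    qed
  qed
qed

lemma branch_path:
  assumes s: "s \<in> S" and g: "g \<in> branch s" and u: "u \<in> lists S"
    and avoid: "\<And>i. g \<otimes> wprod (take i u) \<notin> generate W (link s)"
  shows "g \<otimes> wprod u \<in> branch s"
  using u avoid
proof (induction u rule: rev_induct)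
  case Nil
  then show ?case using g branch_closed[OF g] by simp
next
  case (snoc t u)
  have u: "u \<in> lists S" "t \<in> S" using snoc.prems by auto
  have take: "g \<otimes> wprod (take i u) \<notin> generate W (link s)" for i
    using snoc.prems(2)[of "min i (length u)"] by (cases "i \<le> length u") auto
  have "g \<otimes> wprod u \<in> branch s" using snoc.IH u take by blast
  moreover have "g \<otimes> wprod u \<notin> generate W (link s)" using take[of "length u"] by simp
  ultimately have "g \<otimes> wprod u \<otimes> t \<in> branch s" using branch_step[OF s _ u(2)] by blast
  moreover have "g \<in> carrier W" "wprod u \<in> carrier W" using g branch_closed u lists_S_closed by auto
  ultimately show ?case using u lists_S_closed by (simp add: m_assoc)
qed

text \<open>A cell that straddles the border contains an exit edge. Thus it has a vertex in
  $W_{link(s)}$ and $s$ in its type $T$; finiteness of $W_T$ gives every $q$ in $T$ finite order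
  with $s$, so $T$ lies in the star.\<close>

lemma cell_meets_branch:
  assumes s: "s \<in> S" and A: "A \<in> cells" and meet: "A \<inter> branch s \<noteq> {}" "\<not> A \<subseteq> branch s"
  shows "A \<subseteq> generate W (star s)"
proof (rule ccontr)
  assume not: "\<not> A \<subseteq> generate W (star s)"
  obtain w where w: "w \<in> A" "w \<in> branch s" using meet by blast
  obtain T where T: "spherical W S T" "A = w <# generate W T" and wW: "w \<in> carrier W"
    using cell_at[OF A w(1)] .
  have TS: "T \<subseteq> S" using T by (simp add: spherical_def)
  have "w \<otimes> wprod u \<in> branch s" if "u \<in> lists T" for u
    using that
  proof (induction u rule: rev_induct)
    case Nil
    then show ?case using w wW by simp
  next
    case (snoc t u)
    then have u: "u \<in> lists T" "t \<in> T" by auto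
    then have uS: "u \<in> lists (carrier W)" "t \<in> S" using TS S_carrier by auto
    define x where "x = w \<otimes> wprod u"
    have x: "x \<in> branch s" "x \<in> carrier W" using snoc.IH u uS wW by (auto simp: x_def)
    have "x \<in> A" unfolding T(2) x_def l_coset_def using wprod_in_generate[OF u(1)] by blast
    have "\<not> (x \<in> generate W (link s) \<and> t = s)"
    proof
      assume "x \<in> generate W (link s) \<and> t = s"
      then have xl: "x \<in> generate W (star s)" and sT: "s \<in> T"
        using generate_link_subset_star u by auto
      have "T \<subseteq> star s"
      proof
        fix q assume q: "q \<in> T"
        have "s \<otimes> q \<in> generate W T" using q sT by (intro generate.eng generate.incl)
        then have "ord (s \<otimes> q) \<noteq> 0"
          using finite_subgroup_order[OF _ spherical_subgroup[OF T(1)]] T(1)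
          by (simp add: spherical_def)
        then show "q \<in> star s" using q sT TS by (auto simp: star_def link_def diagram_edge_iff)
      qed
      then have "generate W T \<subseteq> generate W (star s)" by (rule mono_generate)
      moreover have "A = x <# generate W T"
        unfolding T(2) using \<open>x \<in> A\<close> wW spherical_subgroup[OF T(1)]
        by (intro l_repr_independence) (auto simp: T(2))
      ultimately have "A \<subseteq> generate W (star s)"
        using xl by (auto simp: l_coset_def intro: generate.eng)
      then show False using not by blast
    qed
    then have "x \<otimes> t \<in> branch s" using branch_step[OF s x(1) uS(2)] by blast
    then show ?case using uS wW by (simp add: x_def m_assoc)
  qed
  then have "A \<subseteq> branch s"
    using T(2) parabolic_word[OF TS] by (auto simp: l_coset_def)
  then show False using meet by blast
qed

text \<open>This shows that the twist acts somewhere. If $s = bx$ with $c = b^{-1}$, then $x = cs$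
  still has a descent in the star: $s$ itself when $c$ is trivial, and otherwise a descent $t$ of
  $c$, which could disappear only if $s$ were in $W_{link(s)}$.\<close>

lemma self_not_in_branch: assumes s: "s \<in> S" shows "s \<notin> branch s"
proof
  assume "s \<in> branch s"
  then obtain b x where bx: "s = b \<otimes> x" "b \<in> generate W (link s)" "x \<in> carrier W"
    and min: "\<And>q. q \<in> star s \<Longrightarrow> \<not> inversion x q"
    by (auto simp: branch_def)
  have sub: "subgroup (generate W (link s)) W"
    using link_subset S_carrier by (intro generate_is_subgroup) blast
  define c where "c = inv b"
  have b: "b \<in> carrier W" using bx link_closed by blast
  have c: "c \<in> generate W (link s)" "c \<in> carrier W"
    using bx sub b by (simp_all add: c_def subgroup.m_inv_closed)
  have x: "x = c \<otimes> s" using bx b unfolding c_def by (simp flip: m_assoc)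
  show False
  proof (cases "c = \<one>")
    case True
    then show False using min[of s] x s by (simp add: star_def)
  next
    case False
    then obtain t where t: "t \<in> link s" "inversion c t"
      using parabolic_descent[OF link_subset c(1)] by blast
    have tS: "t \<in> S" using t link_subset by blast
    have "t \<otimes> c \<noteq> c \<otimes> s"
    proof
      assume "t \<otimes> c = c \<otimes> s"
      then have "inv c \<otimes> (t \<otimes> c) = s" using c s by (simp flip: m_assoc)
      moreover have "inv c \<otimes> (t \<otimes> c) \<in> generate W (link s)"
        using c t sub by (simp add: subgroup.m_closed subgroup.m_inv_closed generate.incl)
      ultimately show False
        using parabolic_generators[OF link_subset s] self_not_in_link by metis
    qed
    then have "inversion x t" using inversion_mult_right[of c s t] c s t tS x by simp
    then show False using min[of t] t by (simp add: star_def)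
  qed
qed

text \<open>The word starts with $r$, which is then an inversion, whereas generators that are
  inversions of elements of $W_{link(s)}$ belong to the link.\<close>

lemma alt_not_in_link:
  assumes "s \<in> S" "r \<in> S" "ord (r \<otimes> s) = 0" "r \<notin> link s" "n > 0"
  shows "wprod (alt r s n) \<notin> generate W (link s)"
  using inversion_alt_infinite(2)[of r s n] parabolic_inversion[OF link_subset, of _ s r] assms
  by blast

text \<open>The generator $r$ has no descent in the star, so it lies in the branch, and the path $r,
  rs, rsr, ...$ never reaches $W_{link(s)}$, where an exit would be possible.\<close>

lemma alt_in_branch:
  assumes s: "s \<in> S" and r: "r \<in> S" "ord (r \<otimes> s) = 0" "r \<notin> star s"
  shows "wprod (alt r s (Suc n)) \<in> branch s"
proof -
  have link: "r \<notin> link s" using r by (simp add: star_def)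
  have "\<not> inversion r q" if "q \<in> star s" for q
    using that r star_subset[OF s] inversion_S[of r q] by auto
  then have "\<one> \<otimes> r \<in> branch s" using r by (intro branchI generate.one) auto
  then have "r \<in> branch s" using r by simp
  then have "r \<otimes> wprod (alt s r n) \<in> branch s"
  proof (rule branch_path[OF s])
    show "alt s r n \<in> lists S" using s r by (intro alt_in_lists)
    show "r \<otimes> wprod (take i (alt s r n)) \<notin> generate W (link s)" for i
      using alt_not_in_link[OF s r(1,2) link, of "Suc (min i n)"] by (simp add: take_alt)
  qed
  then show ?thesis by simp
qed

text \<open>The translation is a positive power of $rs$. It lies in the branch, and a path from it
  to $gk$ remains there as long as no intermediate point hits $W_{link(s)}$.\<close>

lemma translate_into_branch:
  assumes s: "s \<in> S" and r: "r \<in> S" "ord (r \<otimes> s) = 0" "r \<notin> star s"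
    and K: "finite K" "K \<subseteq> carrier W"
  obtains g where "g \<in> carrier W" "\<And>k. k \<in> K \<Longrightarrow> g \<otimes> k \<in> branch s"
proof -
  have link: "r \<notin> link s" using r by (simp add: star_def)
  have sub: "subgroup (generate W (link s)) W"
    using link_subset S_carrier by (intro generate_is_subgroup) blast
  have "\<forall>k\<in>K. \<exists>u. u \<in> lists S \<and> wprod u = k" using K word_exists by (metis subsetD)
  then obtain word where word: "\<And>k. k \<in> K \<Longrightarrow> word k \<in> lists S" "\<And>k. k \<in> K \<Longrightarrow> wprod (word k) = k"
    by metis
  \<comment> \<open>All prefixes of the chosen words; translated by $g$, these are the points that
    the paths visit.\<close>
  define P where "P = (\<Union>k\<in>K. (\<lambda>i. wprod (take i (word k))) ` {..length (word k)})"
  have P: "finite P" using K by (simp add: P_def)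
  have take: "wprod (take i (word k)) \<in> P" if "k \<in> K" for i k
  proof -
    have "wprod (take (min i (length (word k))) (word k)) \<in> P"
      unfolding P_def using that by (intro UN_I imageI) auto
    moreover have "take (min i (length (word k))) (word k) = take i (word k)"
      by (simp add: min_def)
    ultimately show ?thesis by simp
  qed
  have PW: "p \<in> carrier W" if p: "p \<in> P" for p
  proof -
    obtain k i where "k \<in> K" "p = wprod (take i (word k))" using p by (auto simp: P_def)
    moreover have "take i (word k) \<in> lists S" if "k \<in> K" for i k
      using word(1)[OF that] by (auto simp: in_lists_conv_set dest: in_set_takeD)
    ultimately show ?thesis using lists_S_closed wprod_closed by blast
  qed
  have rs: "r \<otimes> s \<in> carrier W" using r s by simp
  have pow: "(r \<otimes> s) [^] n = wprod (alt r s (2 * n))" for n :: nat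
    using r s by (simp add: wprod_alt_even)
  \<comment> \<open>Pigeonhole: if every power failed, two of them would fail at the same prefix,
    and the quotient would be a nontrivial power of $rs$ inside $W_{link(s)}$. The
    \<open>Suc\<close> ensures that the power is positive, as \<open>alt_in_branch\<close>
    requires.\<close>
  obtain n :: nat where n: "\<And>p. p \<in> P \<Longrightarrow> (r \<otimes> s) [^] Suc n \<otimes> p \<notin> generate W (link s)"
  proof (rule ccontr)
    assume "\<not> thesis"
    then have "\<forall>n::nat. \<exists>p. p \<in> P \<and> (r \<otimes> s) [^] Suc n \<otimes> p \<in> generate W (link s)"
      using that by blast
    then obtain c where c: "\<And>n. c n \<in> P" "\<And>n::nat. (r \<otimes> s) [^] Suc n \<otimes> c n \<in> generate W (link s)"
      by metis
    have "\<not> inj c" using P c(1) finite_subset[of "range c" P] finite_imageD[of c UNIV] by auto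
    then obtain i j where "c i = c j" "i < j" by (metis injI linorder_neqE_nat)
    define x y where "x = (r \<otimes> s) [^] Suc i \<otimes> c i" and "y = (r \<otimes> s) [^] Suc j \<otimes> c i"
    have "x \<in> generate W (link s)" "y \<in> generate W (link s)"
      using c(2)[of i] c(2)[of j] \<open>c i = c j\<close> unfolding x_def y_def by auto
    then have "y \<otimes> inv x \<in> generate W (link s)"
      using sub by (simp add: subgroup.m_closed subgroup.m_inv_closed)
    moreover have "y = (r \<otimes> s) [^] (j - i) \<otimes> x"
    proof -
      have "(r \<otimes> s) [^] Suc j = (r \<otimes> s) [^] (j - i) \<otimes> (r \<otimes> s) [^] Suc i"
        using \<open>i < j\<close> rs by (subst nat_pow_mult) auto
      then show ?thesis unfolding x_def y_def using rs PW[OF c(1)] by (simp only: m_assoc nat_pow_closed)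
    qed
    then have "y \<otimes> inv x = (r \<otimes> s) [^] (j - i)"
      using rs PW[OF c(1)] by (simp add: x_def m_assoc)
    ultimately show False
      using alt_not_in_link[OF s r(1,2) link, of "2 * (j - i)"] \<open>i < j\<close> pow by simp
  qed
  define g where "g = (r \<otimes> s) [^] Suc n"
  have "g \<in> branch s"
    using alt_in_branch[OF s r, of "Suc (2 * n)"] unfolding g_def pow by simp
  then have "g \<otimes> wprod (word k) \<in> branch s" if "k \<in> K" for k
    using word(1)[OF that] by (rule branch_path[OF s]) (use n take that g_def in blast)
  then have "g \<otimes> k \<in> branch s" if "k \<in> K" for k using that word by metis
  moreover have "g \<in> carrier W" using \<open>g \<in> branch s\<close> branch_closed by blast
  ultimately show ?thesis using that by blast
qed

section \<open>The twist along a branch\<close>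

lemma diagram_iso_fixes_star:
  assumes \<alpha>: "diagram_iso \<alpha>" and s: "s \<in> S" and fixed: "\<And>q. q \<in> star s \<Longrightarrow> \<alpha> q = q"
    and x: "x \<in> generate W (star s)"
  shows "\<alpha> x = x"
proof -
  interpret \<alpha>: group_hom W W \<alpha> using \<alpha> by (rule diagram_iso_hom)
  obtain u where u: "u \<in> lists (star s)" "wprod u = x"
    using parabolic_word[OF star_subset[OF s] x] by blast
  have "\<alpha> (wprod u) = wprod u"
    using u(1)
  proof induction
    case (Cons q u)
    then have "u \<in> lists (carrier W)" "q \<in> S"
      using star_subset[OF s] S_carrier by (auto simp: in_lists_conv_set)
    then show ?case using Cons fixed by simp
  qed simp
  then show ?thesis using u by simp
qed

lemma diagram_iso_branch:
  assumes \<alpha>: "diagram_iso \<alpha>" and s: "s \<in> S" and fixed: "\<And>q. q \<in> star s \<Longrightarrow> \<alpha> q = q"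
    and w: "w \<in> branch s"
  shows "\<alpha> w \<in> branch s"
proof -
  interpret \<alpha>: group_hom W W \<alpha> using \<alpha> by (rule diagram_iso_hom)
  obtain b x where bx: "w = b \<otimes> x" "b \<in> generate W (link s)" "x \<in> carrier W"
    and min: "\<And>q. q \<in> star s \<Longrightarrow> \<not> inversion x q"
    using w by (auto simp: branch_def)
  have "\<alpha> b = b"
    using diagram_iso_fixes_star[OF \<alpha> s fixed] bx generate_link_subset_star by blast
  then have "\<alpha> w = b \<otimes> \<alpha> x" using bx link_closed by simp
  moreover have "\<not> inversion (\<alpha> x) q" if "q \<in> star s" for q
  proof -
    have "q \<in> carrier W" using that star_subset[OF s] S_carrier by blast
    then show ?thesis
      using inversion_diagram_iso[OF \<alpha> bx(3), of q] fixed[OF that] min[OF that] by simp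
  qed
  ultimately show ?thesis using bx by (simp add: branchI)
qed

text \<open>The branch is invariant under $\<alpha>$. A cell that meets it is fixed elementwise,
  either because it lies inside or because it lies in $W_{star(s)}$, where $\<alpha>$ is the
  identity; a cell disjoint from it is simply moved by $\<alpha>$.\<close>

lemma twist_cellular:
  assumes \<alpha>: "diagram_iso \<alpha>" and s: "s \<in> S" and fixed: "\<And>q. q \<in> star s \<Longrightarrow> \<alpha> q = q"
  shows "cellular (\<lambda>x. if x \<in> branch s then x else \<alpha> x)" (is "cellular ?h")
proof -
  let ?\<beta> = "inv_into (carrier W) \<alpha>"
  have \<beta>: "diagram_iso ?\<beta>" using \<alpha> by (rule diagram_iso_inv)
  note cell = cellular_diagram_iso[OF \<alpha>]
  note cancel = cellular_inv_cancel[OF cell]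
  have \<beta>_fixed: "?\<beta> q = q" if "q \<in> star s" for q
    using cancel(1)[of q] fixed[OF that] that star_subset[OF s] by auto
  have branch_iff: "\<alpha> x \<in> branch s \<longleftrightarrow> x \<in> branch s" if "x \<in> carrier W" for x
    using diagram_iso_branch[OF \<alpha> s fixed, of x] diagram_iso_branch[OF \<beta> s \<beta>_fixed, of "\<alpha> x"]
      cancel(1)[OF that] by auto
  have bij: "bij_betw ?h (carrier W) (carrier W)"
  proof (rule bij_betw_byWitness[where f' = "\<lambda>x. if x \<in> branch s then x else ?\<beta> x"])
    show "\<forall>x\<in>carrier W. (if ?h x \<in> branch s then ?h x else ?\<beta> (?h x)) = x"
      using branch_iff cancel(1) by simp
    have "?\<beta> x \<in> branch s \<longleftrightarrow> x \<in> branch s" if "x \<in> carrier W" for x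
      using branch_iff[of "?\<beta> x"] cancel(2)[OF that] cellular_closed[OF cellular_inv[OF cell] that]
      by simp
    then show "\<forall>x\<in>carrier W. ?h (if x \<in> branch s then x else ?\<beta> x) = x"
      using cancel(2) by simp
  qed (use cellular_closed[OF cell] cellular_closed[OF cellular_inv[OF cell]] in auto)
  have id: "?h ` A = A" if "A \<in> cells" "A \<inter> branch s \<noteq> {}" for A
  proof (cases "A \<subseteq> branch s")
    case True
    then show ?thesis by force
  next
    case False
    then have "\<alpha> x = x" if "x \<in> A" for x
      using cell_meets_branch[OF s \<open>A \<in> cells\<close> \<open>A \<inter> branch s \<noteq> {}\<close> False] that
        diagram_iso_fixes_star[OF \<alpha> s fixed] by blast
    then show ?thesis by force
  qed
  have off: "?h ` A = \<alpha> ` A" if "A \<inter> branch s = {}" for A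
    using that by (intro image_cong) auto
  have "(\<lambda>A. ?h ` A) ` cells = cells"
  proof
    show "(\<lambda>A. ?h ` A) ` cells \<subseteq> cells"
    proof clarify
      fix A assume A: "A \<in> cells"
      show "?h ` A \<in> cells"
      proof (cases "A \<inter> branch s = {}")
        case True
        show ?thesis unfolding off[OF True] by (rule cellular_image[OF cell A])
      next
        case False
        show ?thesis unfolding id[OF A False] by (rule A)
      qed
    qed
    show "cells \<subseteq> (\<lambda>A. ?h ` A) ` cells"
    proof
      fix A assume A: "A \<in> cells"
      show "A \<in> (\<lambda>A. ?h ` A) ` cells"
      proof (cases "A \<inter> branch s = {}")
        case True
        obtain B where B: "B \<in> cells" "A = \<alpha> ` B" using cell A unfolding cellular_def by blast
        have "B \<inter> branch s = {}" using True branch_iff cell_subset[OF B(1)] B(2) by blast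
        then have "A = ?h ` B" by (simp only: off B(2))
        then show ?thesis using B(1) by (rule image_eqI)
      next
        case False
        show ?thesis by (rule image_eqI[where x = A]) (use id[OF A False] A in simp_all)
      qed
    qed
  qed
  then show ?thesis using bij by (simp add: cellular_def)
qed

lemma nondiscrete_if_flexible:
  assumes "flexible_diagram W S"
  shows "davis_Aut_topology W S \<noteq> discrete_topology (carrier Aut)"
proof
  assume "davis_Aut_topology W S = discrete_topology (carrier Aut)"
  then obtain F where F: "finite F" "F \<subseteq> cells" "pointwise_stabiliser W S F \<subseteq> {\<one>\<^bsub>Aut\<^esub>}"
    unfolding discrete_iff by blast
  obtain s \<phi> r where s: "s \<in> S" and \<phi>: "order_preserving \<phi>" and r: "r \<in> S" "\<phi> r \<noteq> r"
    and \<phi>_fixed: "\<phi> s = s" "\<And>t. diagram_edge W S s t \<Longrightarrow> \<phi> t = t"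
    using assms by (auto simp: flexible_diagram_def diagram_automorphism_iff)
  obtain \<alpha> where \<alpha>: "diagram_iso \<alpha>" and \<alpha>S: "\<And>s. s \<in> S \<Longrightarrow> \<alpha> s = \<phi> s"
    using order_preserving_extends[OF \<phi>] by blast
  interpret \<alpha>: group_hom W W \<alpha> using \<alpha> by (rule diagram_iso_hom)
  have \<phi>_star: "\<phi> q = q" if "q \<in> star s" for q
    using that \<phi>_fixed by (auto simp: star_def link_def)
  then have fixed: "\<alpha> q = q" if "q \<in> star s" for q
    using that \<alpha>S star_subset[OF s] by auto
  have r_star: "r \<notin> star s" using r \<phi>_star by auto
  then have "ord (s \<otimes> r) = 0" using r s by (auto simp: star_def link_def diagram_edge_iff)
  then have ord: "ord (r \<otimes> s) = 0"
    using ord_inv[of "s \<otimes> r"] r s by (simp add: inv_mult_group)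
  have "r \<noteq> s" using r_star by (auto simp: star_def)
  define K where "K = \<Union>F"
  have K: "finite K" "K \<subseteq> carrier W"
    unfolding K_def using F(1,2) cell_finite cell_subset by (blast intro: finite_Union)+
  obtain g where g: "g \<in> carrier W" "\<And>k. k \<in> K \<Longrightarrow> g \<otimes> k \<in> branch s"
    using translate_into_branch[OF s r(1) ord r_star K] by blast
  define h where "h x = (if x \<in> branch s then x else \<alpha> x)" for x
  have h: "cellular h" unfolding h_def using \<alpha> s fixed by (rule twist_cellular)
  \<comment> \<open>Conjugating by left multiplication by $g$ moves the fixed branch over the union
    of \<open>F\<close>, so every element of every cell in \<open>F\<close> is fixed.\<close>
  define h' where "h' = (\<lambda>x. inv g \<otimes> x) \<circ> (h \<circ> (\<lambda>x. g \<otimes> x))"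
  have h': "cellular h'"
    unfolding h'_def using g h by (intro cellular_comp cellular_left_mult) auto
  have "h' k = k" if "k \<in> K" for k
    using g(2)[OF that] g(1) that K(2) by (auto simp: h'_def h_def simp flip: m_assoc)
  then have "h' ` A = A" if "A \<in> F" for A using that by (force simp: K_def)
  then have "induced_map W S h' \<in> pointwise_stabiliser W S F"
    using F induced_map_in_Aut[OF h'] by (auto simp: pointwise_stabiliser_def induced_map_def)
  then have "induced_map W S h' = \<one>\<^bsub>Aut\<^esub>" using F by blast
  then have h'_id: "h' x = x" if "x \<in> carrier W" for x
    using that by (simp add: induced_map_one induced_map_eq_iff)
  \<comment> \<open>The witness of nontriviality is $sr$ rather than $r$, since $r$ lies in the
    branch. From $sr$ a step of type $r$ is never an exit and leads to $s$, which is
    outside.\<close>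
  have "s \<otimes> r \<notin> branch s"
  proof
    assume "s \<otimes> r \<in> branch s"
    then have "s \<otimes> r \<otimes> r \<in> branch s"
      using branch_step[OF s _ r(1)] \<open>r \<noteq> s\<close> by blast
    then show False using self_not_in_branch[OF s] s r by (simp add: m_assoc)
  qed
  then have "h (s \<otimes> r) = s \<otimes> \<phi> r"
    using s r \<alpha>S[of r] \<alpha>S[OF s] \<phi>_fixed(1) by (simp add: h_def)
  moreover have "h' (inv g \<otimes> (s \<otimes> r)) = inv g \<otimes> h (s \<otimes> r)"
  proof -
    have "g \<otimes> (inv g \<otimes> (s \<otimes> r)) = s \<otimes> r" using g s r by (simp flip: m_assoc)
    then show ?thesis by (simp add: h'_def)
  qed
  ultimately have "inv g \<otimes> (s \<otimes> \<phi> r) = inv g \<otimes> (s \<otimes> r)"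
    using h'_id[of "inv g \<otimes> (s \<otimes> r)"] g s r by simp
  moreover have "\<phi> r \<in> S" using \<phi> r bij_betwE by (auto simp: order_preserving_def)
  ultimately show False using r s g by simp
qed

end

theorem mainTheorem3:
  fixes W :: "('a, 'b) monoid_scheme" and S :: "'a set"
  assumes "coxeter_system W S" and "finite S"
  shows
    "((\<forall>f\<in>carrier (davis_Aut W S). \<exists>l\<in>left_mult_auts W S. \<exists>d\<in>diagram_auts W S.
          f = l \<otimes>\<^bsub>davis_Aut W S\<^esub> d)
        \<longleftrightarrow> \<not> flexible_diagram W S) \<and>
     (davis_Aut_topology W S = discrete_topology (carrier (davis_Aut W S))
        \<longleftrightarrow> \<not> flexible_diagram W S) \<and>
     (\<not> flexible_diagram W S \<longleftrightarrow>
        internal_semidirect_product (davis_Aut W S) (left_mult_auts W S) (diagram_auts W S))"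
proof -
  interpret group W
    using assms(1) by (simp add: coxeter_system_def has_presentation_def)
  interpret coxeter_group W S by unfold_locales fact
  \<comment> \<open>These close a cycle: a diagram that is not flexible gives the decomposition, the
    decomposition gives discreteness, and discreteness excludes flexibility. The semidirect product
    is the decomposition again.\<close>
  note discrete_if_decomposable[OF assms(2)] decomposable_if_not_flexible nondiscrete_if_flexible
  then show ?thesis unfolding semidirect_iff by blast
qed

end
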